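(* Let $\mathsf{N}\in\mathsf{NFI}_{\mathrm{PB}_4}(\mathrm{B}_4)$ and let $\psi:\mathsf{F}_2\to S_d$ be a homomorphism that represents a child's drawing $[\psi]\in\mathsf{Dessin}(\mathsf{N})$. Then, for every charming $\mathsf{GT}$-shadow $[m,f]$ in $\mathsf{GT}(\mathsf{N})$, the child's drawing $[\psi]^{[m,f]}$ has the same passport as $[\psi]$.
   Context: Braid groups. $\mathrm{B}_n$ is the Artin braid group on $n$ strands with standard generators $\sigma_1,\dots,\sigma_{n-1}$; $\mathrm{PB}_n\le \mathrm{B}_n$ is the pure braid group with generators $x_{ij} := \sigma_{j-1}\cdots\sigma_{i+1}\sigma_i^2\sigma_{i+1}^{-1}\cdots\sigma_{j-1}^{-1}$, $1\le i<j\le n$. Set $c := x_{23}x_{12}x_{13}\in \mathrm{PB}_3$; it generates the center of $\mathrm{PB}_3$. The elements $x:=x_{12}$, $y:=x_{23}$ generate a free subgroup of rank 2 in $\mathrm{PB}_3$, which is identified with the free group $\mathsf{F}_2$, and $\mathrm{PB}_3=\mathsf{F}_2\times\langle c\rangle$. $\mathsf{NFI}_{\mathrm{PB}_4}(\mathrm{B}_4)$ is the poset of finite index normal subgroups $\mathsf{N}\unlhd \mathrm{B}_4$ with $\mathsf{N}\le\mathrm{PB}_4$. Homomorphisms $\mathrm{PB}_3\to\mathrm{PB}_4$ (values on $x_{12},x_{23},x_{13}$): $\varphi_{123}: x_{12}, x_{23}, x_{13}$; $\varphi_{234}: x_{23}, x_{34}, x_{24}$; $\varphi_{12,3,4}: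 x_{13}x_{23},\ x_{34},\ x_{14}x_{24}$; $\varphi_{1,23,4}: x_{12}x_{13},\ x_{24}x_{34},\ x_{14}$; $\varphi_{1,2,34}: x_{12},\ x_{23}x_{24},\ x_{13}x_{14}$. For $\mathsf{N}\in\mathsf{NFI}_{\mathrm{PB}_4}(\mathrm{B}_4)$ let $\mathsf{N}_{\mathrm{PB}_3}$ be the intersection of the preimages of $\mathsf{N}$ under these five homomorphisms (a finite index normal subgroup of $\mathrm{B}_3$ contained in $\mathrm{PB}_3$), let $N_{\mathrm{ord}}$ be the least common multiple of the orders of $x_{12}\mathsf{N}_{\mathrm{PB}_3}, x_{23}\mathsf{N}_{\mathrm{PB}_3}, c\,\mathsf{N}_{\mathrm{PB}_3}$ in $\mathrm{PB}_3/\mathsf{N}_{\mathrm{PB}_3}$, and $\mathsf{N}_{\mathsf{F}_2}:=\mathsf{N}_{\mathrm{PB}_3}\cap\mathsf{F}_2$. $\mathsf{GT}$-shadows. $\mathsf{GT}(\mathsf{N})$, the set of $\mathsf{GT}$-shadows with target $\mathsf{N}$, is the set of pairs $[m,f]:=(m+N_{\mathrm{ord}}\mathbb{Z},\ f\,\mathsf{N}_{\mathrm{PB}_3})$ represented by some $(m,f)\in\mathbb{Z}\times\mathsf{F}_2$ such that: (i) $\sigma_1 x_{12}^m f^{-1}\sigma_2 x_{23}^m f\,\mathsf{N}_{\mathrm{PB}_3} = f^{-1}\sigma_1\sigma_2 x_{12}^{-m}c^m\,\mathsf{N}_{\mathrm{PB}_3}$ and $f^{-1}\sigma_2x_{23}^m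 f\sigma_1x_{12}^m\,\mathsf{N}_{\mathrm{PB}_3} = \sigma_2\sigma_1x_{23}^{-m}c^m f\,\mathsf{N}_{\mathrm{PB}_3}$ in $\mathrm{B}_3/\mathsf{N}_{\mathrm{PB}_3}$; (ii) $\varphi_{234}(f)\varphi_{1,23,4}(f)\varphi_{123}(f)\,\mathsf{N}=\varphi_{1,2,34}(f)\varphi_{12,3,4}(f)\,\mathsf{N}$ in $\mathrm{PB}_4/\mathsf{N}$; (iii) $2m+1$ is a unit modulo $N_{\mathrm{ord}}$; (iv) the homomorphism $\mathrm{PB}_3\to\mathrm{PB}_3/\mathsf{N}_{\mathrm{PB}_3}$, $x_{12}\mapsto x_{12}^{2m+1}\mathsf{N}_{\mathrm{PB}_3}$, $x_{23}\mapsto f^{-1}x_{23}^{2m+1}f\,\mathsf{N}_{\mathrm{PB}_3}$, $c\mapsto c^{2m+1}\mathsf{N}_{\mathrm{PB}_3}$, is onto. $[m,f]$ is charming if $f\mathsf{N}_{\mathsf{F}_2}$ lies in the commutator subgroup of $\mathsf{F}_2/\mathsf{N}_{\mathsf{F}_2}$. Child's drawings. A child's drawing of degree $d$ is an $S_d$-conjugacy class $[\psi]$ of homomorphisms $\psi:\mathsf{F}_2\to S_d$ with transitive image. It is subordinate to $\mathsf{N}$ if $\mathsf{N}_{\mathsf{F}_2}\le\ker(\psi)$; $\mathsf{Dessin}(\mathsf{N})$ is the set of child's drawings subordinate to $\mathsf{N}$. For $[\psi]\in\mathsf{Dessin}(\mathsf{N})$ and $[m,f]\in\mathsf{GT}(\mathsf{N})$,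 $[\psi]^{[m,f]}$ is the child's drawing represented by $x\mapsto\psi(x^{2m+1})$, $y\mapsto\psi(f^{-1}y^{2m+1}f)$. The passport of $[\psi]$ is the triple of partitions of $d$ given by the cycle structures of $\psi(x)$, $\psi(y)$ and $\psi(y)^{-1}\psi(x)^{-1}$. *)

theory Defs
  imports
    "HOL-Algebra.Generated_Groups"
    "HOL-Algebra.Multiplicative_Group"
    "HOL-Algebra.Sym_Groups"
    "HOL-Combinatorics.Orbits"
    "HOL-Combinatorics.Transposition"
    "HOL-Library.Multiset"
    "HOL-Number_Theory.Cong"
begin

section \<open>Artin braid groups\<close>

text \<open>
  A letter (i, True) stands for the i-th standard generator and (i, False) for its inverse.
  The braid group on n strands is given by Artin's presentation: words in these letters modulo
  the least congruence that contains the braid relations and free cancellation.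
\<close>

type_synonym braid_word = "(nat \<times> bool) list"
type_synonym braid = "braid_word set"

definition braid_words :: "nat \<Rightarrow> braid_word set" where
  "braid_words n = lists ({1..<n} \<times> UNIV)"

inductive braid_eq :: "nat \<Rightarrow> braid_word \<Rightarrow> braid_word \<Rightarrow> bool" for n :: nat where
  refl: "w \<in> braid_words n \<Longrightarrow> braid_eq n w w"
| sym: "braid_eq n u v \<Longrightarrow> braid_eq n v u"
| trans: "braid_eq n u v \<Longrightarrow> braid_eq n v w \<Longrightarrow> braid_eq n u w"
| append: "braid_eq n u u' \<Longrightarrow> braid_eq n v v' \<Longrightarrow> braid_eq n (u @ v) (u' @ v')"
| cancel: "1 \<le> i \<Longrightarrow> i < n \<Longrightarrow> braid_eq n [(i, b), (i, \<not> b)] []"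
| far: "1 \<le> i \<Longrightarrow> i + 2 \<le> j \<Longrightarrow> j < n \<Longrightarrow>
    braid_eq n [(i, True), (j, True)] [(j, True), (i, True)]"
| braid: "1 \<le> i \<Longrightarrow> i + 1 < n \<Longrightarrow>
    braid_eq n [(i, True), (i + 1, True), (i, True)] [(i + 1, True), (i, True), (i + 1, True)]"

definition braid_rel :: "nat \<Rightarrow> (braid_word \<times> braid_word) set" where
  "braid_rel n = {(u, v). braid_eq n u v}"

definition braid_group :: "nat \<Rightarrow> braid monoid" where
  "braid_group n =
     \<lparr>carrier = braid_words n // braid_rel n,
      monoid.mult = (\<lambda>A B. \<Union>u\<in>A. \<Union>v\<in>B. braid_rel n `` {u @ v}),
      one = braid_rel n `` {[]}\<rparr>"

definition sigma :: "nat \<Rightarrow> nat \<Rightarrow> braid" where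
  "sigma n i = braid_rel n `` {[(i, True)]}"

primrec word_perm :: "braid_word \<Rightarrow> nat \<Rightarrow> nat" where
  "word_perm [] = id"
| "word_perm (l # w) = transpose (fst l) (Suc (fst l)) \<circ> word_perm w"

definition braid_perm :: "braid \<Rightarrow> nat \<Rightarrow> nat" where
  "braid_perm g = the_elem (word_perm ` g)"

definition PB :: "nat \<Rightarrow> braid set" where
  "PB n = kernel (braid_group n) (sym_group n) braid_perm"

definition PB_group :: "nat \<Rightarrow> braid monoid" where
  "PB_group n = (braid_group n)\<lparr>carrier := PB n\<rparr>"


subsection \<open>Basic facts\<close>

lemma braid_eq_words: "braid_eq n u v \<Longrightarrow> u \<in> braid_words n \<and> v \<in> braid_words n"
  by (induction rule: braid_eq.induct) (auto simp: braid_words_def)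

lemma equiv_braid_rel: "equiv (braid_words n) (braid_rel n)"
  by (rule equivI)
    (auto simp: braid_rel_def refl_on_def sym_def trans_def
      intro: braid_eq.refl braid_eq.sym braid_eq.trans dest: braid_eq_words)

lemma braid_class_eq_iff:
  "u \<in> braid_words n \<Longrightarrow> v \<in> braid_words n \<Longrightarrow>
     braid_rel n `` {u} = braid_rel n `` {v} \<longleftrightarrow> braid_eq n u v"
  using eq_equiv_class_iff[OF equiv_braid_rel, of u n v] by (simp add: braid_rel_def)

lemma braid_class_mult:
  assumes "u \<in> braid_words n" "v \<in> braid_words n"
  shows "braid_rel n `` {u} \<otimes>\<^bsub>braid_group n\<^esub> braid_rel n `` {v} = braid_rel n `` {u @ v}"
proof -
  have *: "braid_rel n `` {u' @ v'} = braid_rel n `` {u @ v}"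
    if "braid_eq n u u'" "braid_eq n v v'" for u' v'
    using braid_eq.append[OF that] equiv_class_eq[OF equiv_braid_rel, of "u @ v" "u' @ v'" n]
    by (simp add: braid_rel_def)
  have self: "u \<in> braid_rel n `` {u}" "v \<in> braid_rel n `` {v}"
    using assms equiv_class_self[OF equiv_braid_rel] by auto
  have "(\<Union>u'\<in>braid_rel n `` {u}. \<Union>v'\<in>braid_rel n `` {v}. braid_rel n `` {u' @ v'})
      = (\<Union>u'\<in>braid_rel n `` {u}. \<Union>v'\<in>braid_rel n `` {v}. braid_rel n `` {u @ v})"
    by (intro SUP_cong) (use * in \<open>simp_all add: braid_rel_def\<close>)
  also have "\<dots> = braid_rel n `` {u @ v}"
    using self by blast
  finally show ?thesis
    by (simp add: braid_group_def)
qed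

lemma braid_carrierE:
  assumes "g \<in> carrier (braid_group n)"
  obtains w where "w \<in> braid_words n" "g = braid_rel n `` {w}"
  using assms by (auto simp: braid_group_def elim: quotientE)

lemma braid_class_in_carrier:
  "w \<in> braid_words n \<Longrightarrow> braid_rel n `` {w} \<in> carrier (braid_group n)"
  by (simp add: braid_group_def quotientI)

lemma append_in_braid_words:
  "u \<in> braid_words n \<Longrightarrow> v \<in> braid_words n \<Longrightarrow> u @ v \<in> braid_words n"
  by (simp add: braid_words_def)

lemma Nil_in_braid_words: "[] \<in> braid_words n"
  by (simp add: braid_words_def)

definition inv_word :: "braid_word \<Rightarrow> braid_word" where
  "inv_word w = rev (map (apsnd Not) w)"

lemma inv_word_in_braid_words: "w \<in> braid_words n \<Longrightarrow> inv_word w \<in> braid_words n"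
  by (induction w) (auto simp: braid_words_def inv_word_def)

lemma inv_word_cancel: "w \<in> braid_words n \<Longrightarrow> braid_eq n (inv_word w @ w) []"
proof (induction w)
  case Nil
  show ?case by (simp add: inv_word_def braid_eq.refl Nil_in_braid_words)
next
  case (Cons l w)
  obtain i b where l: "l = (i, b)" by (cases l)
  have w: "w \<in> braid_words n" and i: "1 \<le> i" "i < n"
    using Cons.prems l by (auto simp: braid_words_def)
  have "braid_eq n ([(i, \<not> b), (i, b)] @ w) ([] @ w)"
    by (rule braid_eq.append[OF _ braid_eq.refl[OF w]]) (use braid_eq.cancel[OF i, of "\<not> b"] in simp)
  hence "braid_eq n (inv_word w @ ([(i, \<not> b), (i, b)] @ w)) (inv_word w @ ([] @ w))"
    by (rule braid_eq.append[OF braid_eq.refl[OF inv_word_in_braid_words[OF w]]])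
  from braid_eq.trans[OF this] show ?case
    using Cons.IH[OF w] by (simp add: inv_word_def l)
qed

lemma group_braid_group: "group (braid_group n)"
proof (rule groupI)
  have one: "\<one>\<^bsub>braid_group n\<^esub> = braid_rel n `` {[]}" by (simp add: braid_group_def)
  show "\<one>\<^bsub>braid_group n\<^esub> \<in> carrier (braid_group n)"
    by (simp add: one braid_class_in_carrier Nil_in_braid_words)
  show "g \<otimes>\<^bsub>braid_group n\<^esub> h \<in> carrier (braid_group n)"
    if "g \<in> carrier (braid_group n)" "h \<in> carrier (braid_group n)" for g h
    using that
    by (elim braid_carrierE)
      (simp add: braid_class_mult braid_class_in_carrier append_in_braid_words)
  show "g \<otimes>\<^bsub>braid_group n\<^esub> h \<otimes>\<^bsub>braid_group n\<^esub> k = g \<otimes>\<^bsub>braid_group n\<^esub> (h \<otimes>\<^bsub>braid_group n\<^esub> k)"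
    if "g \<in> carrier (braid_group n)" "h \<in> carrier (braid_group n)"
      "k \<in> carrier (braid_group n)" for g h k
    using that by (elim braid_carrierE) (simp add: braid_class_mult append_in_braid_words)
  show "\<one>\<^bsub>braid_group n\<^esub> \<otimes>\<^bsub>braid_group n\<^esub> g = g" if "g \<in> carrier (braid_group n)" for g
    using that by (elim braid_carrierE) (simp add: one braid_class_mult Nil_in_braid_words)
  show "\<exists>h\<in>carrier (braid_group n). h \<otimes>\<^bsub>braid_group n\<^esub> g = \<one>\<^bsub>braid_group n\<^esub>"
    if "g \<in> carrier (braid_group n)" for g
  proof -
    obtain w where w: "w \<in> braid_words n" "g = braid_rel n `` {w}"
      using \<open>g \<in> carrier (braid_group n)\<close> by (rule braid_carrierE)
    have "braid_rel n `` {inv_word w} \<otimes>\<^bsub>braid_group n\<^esub> g = braid_rel n `` {[]}"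
      using w inv_word_cancel[OF w(1)]
      by (simp add: braid_class_mult inv_word_in_braid_words braid_class_eq_iff
          append_in_braid_words Nil_in_braid_words)
    thus ?thesis
      using braid_class_in_carrier[OF inv_word_in_braid_words[OF w(1)]] one by auto
  qed
qed

lemma word_perm_append: "word_perm (u @ v) = word_perm u \<circ> word_perm v"
  by (induction u) (simp_all add: comp_assoc)

lemma braid_eq_word_perm: "braid_eq n u v \<Longrightarrow> word_perm u = word_perm v"
proof (induction rule: braid_eq.induct)
  case (far i j)
  thus ?case by (auto simp: fun_eq_iff transpose_def)
next
  case (braid i)
  thus ?case by (auto simp: fun_eq_iff transpose_def)
qed (simp_all add: word_perm_append)

lemma braid_perm_class: "w \<in> braid_words n \<Longrightarrow> braid_perm (braid_rel n `` {w}) = word_perm w"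
proof -
  assume "w \<in> braid_words n"
  hence "word_perm ` (braid_rel n `` {w}) = {word_perm w}"
    using braid_eq.refl by (auto simp: braid_rel_def dest: braid_eq_word_perm)
  thus ?thesis by (simp add: braid_perm_def)
qed

lemma word_perm_permutes: "w \<in> braid_words n \<Longrightarrow> word_perm w permutes {1..n}"
proof (induction w)
  case Nil
  show ?case unfolding word_perm.simps by (rule permutes_id)
next
  case (Cons l w)
  hence "word_perm w permutes {1..n}" "fst l \<in> {1..n}" "Suc (fst l) \<in> {1..n}"
    by (auto simp: braid_words_def)
  thus ?case
    unfolding word_perm.simps by (intro permutes_compose permutes_swap_id)
qed

lemma braid_perm_hom: "braid_perm \<in> hom (braid_group n) (sym_group n)"
proof (rule homI)
  show "braid_perm g \<in> carrier (sym_group n)" if "g \<in> carrier (braid_group n)" for g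
    using that
    by (elim braid_carrierE) (simp add: braid_perm_class sym_group_carrier word_perm_permutes del: One_nat_def)
  show "braid_perm (g \<otimes>\<^bsub>braid_group n\<^esub> h) = braid_perm g \<otimes>\<^bsub>sym_group n\<^esub> braid_perm h"
    if "g \<in> carrier (braid_group n)" "h \<in> carrier (braid_group n)" for g h
    using that
    by (elim braid_carrierE)
      (simp add: braid_class_mult braid_perm_class append_in_braid_words word_perm_append
        sym_group_mult)
qed


section \<open>Pure braid generators, the free subgroup and finite index subgroups\<close>

definition sigma_conjugator :: "nat \<Rightarrow> nat \<Rightarrow> nat \<Rightarrow> braid" where
  "sigma_conjugator n i j =
     foldr (\<otimes>\<^bsub>braid_group n\<^esub>) (map (sigma n) (rev [Suc i..<j])) \<one>\<^bsub>braid_group n\<^esub>"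

definition pure_gen :: "nat \<Rightarrow> nat \<Rightarrow> nat \<Rightarrow> braid" where
  "pure_gen n i j =
     sigma_conjugator n i j \<otimes>\<^bsub>braid_group n\<^esub> (sigma n i [^]\<^bsub>braid_group n\<^esub> (2::nat))
       \<otimes>\<^bsub>braid_group n\<^esub> inv\<^bsub>braid_group n\<^esub> (sigma_conjugator n i j)"

abbreviation B3 :: "braid monoid" where "B3 \<equiv> braid_group 3"
abbreviation B4 :: "braid monoid" where "B4 \<equiv> braid_group 4"

abbreviation x12 :: braid where "x12 \<equiv> pure_gen 3 1 2"
abbreviation x23 :: braid where "x23 \<equiv> pure_gen 3 2 3"
abbreviation x13 :: braid where "x13 \<equiv> pure_gen 3 1 3"

definition central :: braid where
  "central = x23 \<otimes>\<^bsub>B3\<^esub> x12 \<otimes>\<^bsub>B3\<^esub> x13"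

text \<open>The free group of rank 2 is, by identification, the subgroup of B3 generated by
  x = x12 and y = x23.\<close>

definition F2 :: "braid set" where
  "F2 = generate B3 {x12, x23}"

definition F2_group :: "braid monoid" where
  "F2_group = B3\<lparr>carrier := F2\<rparr>"

definition NFI :: "braid set set" where
  "NFI = {N. N \<lhd> B4 \<and> N \<subseteq> PB 4 \<and> finite (rcosets\<^bsub>B4\<^esub> N)}"


section \<open>The five homomorphisms from PB3 to PB4\<close>

text \<open>Since PB3 is generated by x12, x23 and x13, a homomorphism defined on it is determined by
  its values there; the choice operator below therefore only chooses values off PB3.\<close>

definition PB3_hom :: "braid \<Rightarrow> braid \<Rightarrow> braid \<Rightarrow> braid \<Rightarrow> braid" where
  "PB3_hom a b c =
     (SOME \<phi>. \<phi> \<in> hom (PB_group 3) (PB_group 4) \<and> \<phi> x12 = a \<and> \<phi> x23 = b \<and> \<phi> x13 = c)"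

definition phi_123 :: "braid \<Rightarrow> braid" where
  "phi_123 = PB3_hom (pure_gen 4 1 2) (pure_gen 4 2 3) (pure_gen 4 1 3)"

definition phi_234 :: "braid \<Rightarrow> braid" where
  "phi_234 = PB3_hom (pure_gen 4 2 3) (pure_gen 4 3 4) (pure_gen 4 2 4)"

definition phi_12_3_4 :: "braid \<Rightarrow> braid" where
  "phi_12_3_4 = PB3_hom (pure_gen 4 1 3 \<otimes>\<^bsub>B4\<^esub> pure_gen 4 2 3) (pure_gen 4 3 4)
     (pure_gen 4 1 4 \<otimes>\<^bsub>B4\<^esub> pure_gen 4 2 4)"

definition phi_1_23_4 :: "braid \<Rightarrow> braid" where
  "phi_1_23_4 = PB3_hom (pure_gen 4 1 2 \<otimes>\<^bsub>B4\<^esub> pure_gen 4 1 3)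
     (pure_gen 4 2 4 \<otimes>\<^bsub>B4\<^esub> pure_gen 4 3 4) (pure_gen 4 1 4)"

definition phi_1_2_34 :: "braid \<Rightarrow> braid" where
  "phi_1_2_34 = PB3_hom (pure_gen 4 1 2) (pure_gen 4 2 3 \<otimes>\<^bsub>B4\<^esub> pure_gen 4 2 4)
     (pure_gen 4 1 3 \<otimes>\<^bsub>B4\<^esub> pure_gen 4 1 4)"

definition N_PB3 :: "braid set \<Rightarrow> braid set" where
  "N_PB3 N =
     {g \<in> PB 3. \<forall>\<phi>\<in>{phi_123, phi_234, phi_12_3_4, phi_1_23_4, phi_1_2_34}. \<phi> g \<in> N}"

definition N_ord :: "braid set \<Rightarrow> nat" where
  "N_ord N =
     (let Q = PB_group 3 Mod N_PB3 N;
          o' = (\<lambda>g. group.ord Q (N_PB3 N #>\<^bsub>PB_group 3\<^esub> g))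
      in lcm (o' x12) (lcm (o' x23) (o' central)))"

definition N_F2 :: "braid set \<Rightarrow> braid set" where
  "N_F2 N = N_PB3 N \<inter> F2"


section \<open>GT-shadows\<close>

text \<open>All subgroups occurring here are normal, so a left coset in the source is written as
  the right coset of the library's quotient groups.\<close>

definition hexagons :: "braid set \<Rightarrow> int \<Rightarrow> braid \<Rightarrow> bool" where
  "hexagons N m f \<longleftrightarrow>
     (let s1 = sigma 3 1; s2 = sigma 3 2; K = N_PB3 N in
       K #>\<^bsub>B3\<^esub> (s1 \<otimes>\<^bsub>B3\<^esub> x12 [^]\<^bsub>B3\<^esub> m \<otimes>\<^bsub>B3\<^esub> inv\<^bsub>B3\<^esub> f \<otimes>\<^bsub>B3\<^esub> s2 \<otimes>\<^bsub>B3\<^esub> x23 [^]\<^bsub>B3\<^esub> m \<otimes>\<^bsub>B3\<^esub> f)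
         = K #>\<^bsub>B3\<^esub> (inv\<^bsub>B3\<^esub> f \<otimes>\<^bsub>B3\<^esub> s1 \<otimes>\<^bsub>B3\<^esub> s2 \<otimes>\<^bsub>B3\<^esub> x12 [^]\<^bsub>B3\<^esub> (- m) \<otimes>\<^bsub>B3\<^esub> central [^]\<^bsub>B3\<^esub> m)
       \<and> K #>\<^bsub>B3\<^esub> (inv\<^bsub>B3\<^esub> f \<otimes>\<^bsub>B3\<^esub> s2 \<otimes>\<^bsub>B3\<^esub> x23 [^]\<^bsub>B3\<^esub> m \<otimes>\<^bsub>B3\<^esub> f \<otimes>\<^bsub>B3\<^esub> s1 \<otimes>\<^bsub>B3\<^esub> x12 [^]\<^bsub>B3\<^esub> m)
         = K #>\<^bsub>B3\<^esub> (s2 \<otimes>\<^bsub>B3\<^esub> s1 \<otimes>\<^bsub>B3\<^esub> x23 [^]\<^bsub>B3\<^esub> (- m) \<otimes>\<^bsub>B3\<^esub> central [^]\<^bsub>B3\<^esub> m \<otimes>\<^bsub>B3\<^esub> f))"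

definition pentagon :: "braid set \<Rightarrow> braid \<Rightarrow> bool" where
  "pentagon N f \<longleftrightarrow>
     N #>\<^bsub>PB_group 4\<^esub> (phi_234 f \<otimes>\<^bsub>PB_group 4\<^esub> phi_1_23_4 f \<otimes>\<^bsub>PB_group 4\<^esub> phi_123 f)
       = N #>\<^bsub>PB_group 4\<^esub> (phi_1_2_34 f \<otimes>\<^bsub>PB_group 4\<^esub> phi_12_3_4 f)"

definition unit_condition :: "braid set \<Rightarrow> int \<Rightarrow> bool" where
  "unit_condition N m \<longleftrightarrow> (\<exists>u. [(2 * m + 1) * u = 1] (mod int (N_ord N)))"

definition onto_condition :: "braid set \<Rightarrow> int \<Rightarrow> braid \<Rightarrow> bool" where
  "onto_condition N m f \<longleftrightarrow>
     (let K = N_PB3 N; Q = PB_group 3 Mod K; k = 2 * m + 1 in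
      \<exists>T\<in>hom (PB_group 3) Q.
        T x12 = K #>\<^bsub>PB_group 3\<^esub> (x12 [^]\<^bsub>B3\<^esub> k)
        \<and> T x23 = K #>\<^bsub>PB_group 3\<^esub> (inv\<^bsub>B3\<^esub> f \<otimes>\<^bsub>B3\<^esub> x23 [^]\<^bsub>B3\<^esub> k \<otimes>\<^bsub>B3\<^esub> f)
        \<and> T central = K #>\<^bsub>PB_group 3\<^esub> (central [^]\<^bsub>B3\<^esub> k)
        \<and> T ` PB 3 = carrier Q)"

type_synonym gt_pair = "int set \<times> braid set"

definition gt_class :: "braid set \<Rightarrow> int \<Rightarrow> braid \<Rightarrow> gt_pair" where
  "gt_class N m f = ({m + int (N_ord N) * k | k. True}, N_PB3 N #>\<^bsub>PB_group 3\<^esub> f)"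

definition GT :: "braid set \<Rightarrow> gt_pair set" where
  "GT N = {gt_class N m f | m f. f \<in> F2 \<and> hexagons N m f \<and> pentagon N f
             \<and> unit_condition N m \<and> onto_condition N m f}"

definition charming :: "braid set \<Rightarrow> gt_pair \<Rightarrow> bool" where
  "charming N s \<longleftrightarrow>
     (\<exists>m f. f \<in> F2 \<and> s = gt_class N m f
        \<and> N_F2 N #>\<^bsub>F2_group\<^esub> f
            \<in> derived (F2_group Mod N_F2 N) (carrier (F2_group Mod N_F2 N)))"


section \<open>Child's drawings\<close>

definition transitive_hom :: "nat \<Rightarrow> (braid \<Rightarrow> nat \<Rightarrow> nat) \<Rightarrow> bool" where
  "transitive_hom d \<psi> \<longleftrightarrow> (\<forall>i\<in>{1..d}. \<forall>j\<in>{1..d}. \<exists>w\<in>F2. \<psi> w i = j)"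

text \<open>Homomorphisms are total functions whose values off F2 are irrelevant; a conjugacy class
  contains all functions that represent one of its members on F2.\<close>

definition conj_class :: "nat \<Rightarrow> (braid \<Rightarrow> nat \<Rightarrow> nat) \<Rightarrow> (braid \<Rightarrow> nat \<Rightarrow> nat) set" where
  "conj_class d \<psi> =
     {\<chi> \<in> hom F2_group (sym_group d). \<exists>g\<in>carrier (sym_group d). \<forall>w\<in>F2.
        \<chi> w = g \<otimes>\<^bsub>sym_group d\<^esub> \<psi> w \<otimes>\<^bsub>sym_group d\<^esub> inv\<^bsub>sym_group d\<^esub> g}"

definition Dessin :: "nat \<Rightarrow> braid set \<Rightarrow> (braid \<Rightarrow> nat \<Rightarrow> nat) set set" where
  "Dessin d N =
     {conj_class d \<psi> | \<psi>. d \<ge> 1 \<and> \<psi> \<in> hom F2_group (sym_group d) \<and> transitive_hom d \<psi>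
        \<and> N_F2 N \<subseteq> kernel F2_group (sym_group d) \<psi>}"

text \<open>F2 is free on x12 and x23, so the homomorphism chosen here exists and is unique on F2.\<close>

definition twisted_hom ::
  "nat \<Rightarrow> (braid \<Rightarrow> nat \<Rightarrow> nat) \<Rightarrow> int \<Rightarrow> braid \<Rightarrow> braid \<Rightarrow> nat \<Rightarrow> nat" where
  "twisted_hom d \<psi> m f =
     (SOME \<chi>. \<chi> \<in> hom F2_group (sym_group d)
        \<and> \<chi> x12 = \<psi> (x12 [^]\<^bsub>B3\<^esub> (2 * m + 1))
        \<and> \<chi> x23 = \<psi> (inv\<^bsub>B3\<^esub> f \<otimes>\<^bsub>B3\<^esub> x23 [^]\<^bsub>B3\<^esub> (2 * m + 1) \<otimes>\<^bsub>B3\<^esub> f))"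

definition dessin_act ::
  "nat \<Rightarrow> (braid \<Rightarrow> nat \<Rightarrow> nat) \<Rightarrow> int \<Rightarrow> braid \<Rightarrow> (braid \<Rightarrow> nat \<Rightarrow> nat) set" where
  "dessin_act d \<psi> m f = conj_class d (twisted_hom d \<psi> m f)"

definition cycle_structure :: "nat \<Rightarrow> (nat \<Rightarrow> nat) \<Rightarrow> nat multiset" where
  "cycle_structure d p = image_mset card (mset_set (orbit p ` {1..d}))"

definition hom_passport ::
  "nat \<Rightarrow> (braid \<Rightarrow> nat \<Rightarrow> nat) \<Rightarrow> nat multiset \<times> nat multiset \<times> nat multiset" where
  "hom_passport d \<psi> =
     (cycle_structure d (\<psi> x12),
      cycle_structure d (\<psi> x23),
      cycle_structure d
        (inv\<^bsub>sym_group d\<^esub> (\<psi> x23) \<otimes>\<^bsub>sym_group d\<^esub> inv\<^bsub>sym_group d\<^esub> (\<psi> x12)))"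

text \<open>Conjugate homomorphisms have the same cycle structures, so this image is a singleton.\<close>

definition passport ::
  "nat \<Rightarrow> (braid \<Rightarrow> nat \<Rightarrow> nat) set \<Rightarrow> nat multiset \<times> nat multiset \<times> nat multiset" where
  "passport d D = the_elem (hom_passport d ` D)"

end

theory Submission
  imports Defs
begin

text \<open>
  Put \<open>K = N_PB3 N\<close> and \<open>k = 2m + 1\<close>, and let \<open>\<chi>\<close> be the twisted homomorphism.  The permutations \<open>\<chi> x\<close>
  and \<open>\<chi> y\<close> are conjugate to \<open>\<psi> x ^ k\<close> and \<open>\<psi> y ^ k\<close>.  Modulo \<open>K\<close>, the elements \<open>S = \<sigma>1 x ^ m\<close> and
  \<open>T = f\<inverse> \<sigma>2 y ^ m f\<close> satisfy \<open>S S = x ^ k\<close> and \<open>T T = f\<inverse> y ^ k f\<close>, and the hexagon relations evaluate \<open>S T\<close>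
  and \<open>T S\<close>; hence \<open>S S T T = S (S T) (T S) S\<inverse>\<close> is conjugate to \<open>(x y) ^ k\<close>.  The conjugator is pure, so after
  removing a central factor it lies in the free group, and \<open>\<chi> x \<chi> y\<close> is conjugate to \<open>\<psi> (x y) ^ k\<close>.  Since
  \<open>k\<close> is a unit modulo the orders of \<open>x\<close>, \<open>y\<close> and \<open>x y\<close>, taking \<open>k\<close>-th powers preserves cycle structures.
  All this needs \<open>K\<close> to be normal in \<open>B3\<close>: the five homomorphisms are strand doublings, and conjugation in
  \<open>B3\<close> permutes them up to inner automorphisms of \<open>B4\<close>.
\<close>

section \<open>Two elements satisfying the braid relation\<close>

text \<open>These rules complement \<open>m_assoc\<close> and \<open>inv_mult_group\<close>: in
  products nested to the right, \<open>simp\<close> can then cancel adjacent inverse letters, which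
  settles many of the word identities below.\<close>

lemma (in group) inv_cancel_left [simp]:
  "x \<in> carrier G \<Longrightarrow> z \<in> carrier G \<Longrightarrow> x \<otimes> (inv x \<otimes> z) = z"
  "x \<in> carrier G \<Longrightarrow> z \<in> carrier G \<Longrightarrow> inv x \<otimes> (x \<otimes> z) = z"
  by (simp_all flip: m_assoc)

lemma (in group) conj_int_pow:
  assumes "g \<in> carrier G" "u \<in> carrier G"
  shows "(g \<otimes> u \<otimes> inv g) [^] (k::int) = g \<otimes> u [^] k \<otimes> inv g"
proof -
  have "(\<lambda>u. g \<otimes> u \<otimes> inv g) \<in> hom G G"
    using assms(1) by (intro homI) (simp_all add: m_assoc)
  from hom_int_pow[OF this assms(2)] show ?thesis by (simp add: is_group)
qed

lemma (in group) int_pow_commute: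
  assumes "x \<otimes> y = y \<otimes> x" "x \<in> carrier G" "y \<in> carrier G"
  shows "x [^] (k::int) \<otimes> y = y \<otimes> x [^] k"
proof -
  have "y \<otimes> x \<otimes> inv y = x" using assms by (metis inv_solve_right m_closed)
  hence "x [^] k = y \<otimes> x [^] k \<otimes> inv y"
    using conj_int_pow[OF assms(3,2), of k] by simp
  hence "x [^] k \<otimes> y = y \<otimes> x [^] k \<otimes> inv y \<otimes> y" by simp
  thus ?thesis using assms by (simp add: m_assoc)
qed

lemma (in group) commute_mult:
  assumes "d \<otimes> x = x \<otimes> d" "d \<otimes> y = y \<otimes> d" "d \<in> carrier G" "x \<in> carrier G" "y \<in> carrier G"
  shows "d \<otimes> (x \<otimes> y) = x \<otimes> y \<otimes> d"
  using assms by (metis m_assoc)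

text \<open>Each of the two equal factors is \<open>x\<close> to the power \<open>2 * m + 1\<close>.
  The lemma supplies the squares \<open>S S\<close> and \<open>T T\<close> in
  \<open>hexagon_conj\<close>.\<close>

lemma (in group) int_pow_odd:
  assumes "x \<in> carrier G"
  shows "x \<otimes> (x \<otimes> x) [^] (m::int) \<otimes> (x \<otimes> (x \<otimes> x) [^] m) = (x \<otimes> x) [^] (2 * m + 1)"
proof -
  have "x \<otimes> x = x [^] (2::int)" using int_pow_mult[OF assms, of 1 1] assms by simp
  hence "(x \<otimes> x) [^] j = x [^] (2 * j)" for j :: int
    using int_pow_pow[OF assms] by simp
  moreover have "x \<otimes> x [^] i = x [^] (1 + i)" for i :: int
    using int_pow_mult[OF assms, of 1 i] assms by simp
  ultimately show ?thesis
    using assms by (simp add: int_pow_mult [symmetric] algebra_simps)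
qed

text \<open>The setting is abstract because the same identities are needed in \<open>B3\<close>, in
  its quotient by \<open>N_PB3 N\<close>, and for pairs of neighbouring generators in
  \<open>B4\<close>.\<close>

locale braid_pair = group +
  fixes a b
  assumes a [simp]: "a \<in> carrier G" and b [simp]: "b \<in> carrier G"
    and braid: "a \<otimes> b \<otimes> a = b \<otimes> a \<otimes> b"
begin

lemma aba [simp]: "a \<otimes> (b \<otimes> a) = b \<otimes> (a \<otimes> b)"
  using braid by (simp add: m_assoc)

lemma abaz [simp]:
  assumes [simp]: "z \<in> carrier G"
  shows "a \<otimes> (b \<otimes> (a \<otimes> z)) = b \<otimes> (a \<otimes> (b \<otimes> z))"
proof -
  have "a \<otimes> (b \<otimes> (a \<otimes> z)) = a \<otimes> (b \<otimes> a) \<otimes> z" by (simp add: m_assoc del: aba)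
  thus ?thesis by (simp add: m_assoc)
qed

text \<open>The word \<open>ababa\<close> contains \<open>aba\<close> at its beginning and at its
  end; rewriting one or the other gives the two sides. As a rewrite rule this resolves that overlap
  of \<open>aba\<close> with itself.\<close>

lemma abbab [simp]: "a \<otimes> (b \<otimes> (b \<otimes> (a \<otimes> b))) = b \<otimes> (a \<otimes> (b \<otimes> (b \<otimes> a)))"
  using abaz[of "b \<otimes> a"] by (simp flip: aba)

lemma abbabz [simp]:
  assumes [simp]: "z \<in> carrier G"
  shows "a \<otimes> (b \<otimes> (b \<otimes> (a \<otimes> (b \<otimes> z)))) = b \<otimes> (a \<otimes> (b \<otimes> (b \<otimes> (a \<otimes> z))))"
proof -
  have "a \<otimes> (b \<otimes> (b \<otimes> (a \<otimes> (b \<otimes> z)))) = a \<otimes> (b \<otimes> (b \<otimes> (a \<otimes> b))) \<otimes> z"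
    by (simp add: m_assoc del: abbab)
  thus ?thesis by (simp add: m_assoc)
qed

text \<open>With \<open>a\<close> and \<open>b\<close> the generators of \<open>B3\<close>,
  \<open>z\<close> is \<open>x13\<close> and \<open>c\<close> is the element \<open>central\<close>,
  that is \<open>x23 x12 x13\<close>.\<close>

abbreviation z where "z \<equiv> b \<otimes> (a \<otimes> a) \<otimes> inv b"
abbreviation c where "c \<equiv> b \<otimes> b \<otimes> (a \<otimes> a) \<otimes> z"

lemma conj_a: "a \<otimes> b \<otimes> inv a = inv b \<otimes> a \<otimes> b"
  by (rule inv_solve_right'[THEN iffD2] | simp add: m_assoc)+

lemma conj_b: "b \<otimes> a \<otimes> inv b = inv a \<otimes> b \<otimes> a"
  by (rule inv_solve_right'[THEN iffD2] | simp add: m_assoc del: aba flip: aba)+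

lemma z_alt: "z = inv a \<otimes> (b \<otimes> b) \<otimes> a"
proof -
  have "z = (b \<otimes> a \<otimes> inv b) \<otimes> (b \<otimes> a \<otimes> inv b)" by (simp add: m_assoc)
  thus ?thesis unfolding conj_b by (simp add: m_assoc)
qed

lemma c_alt: "c = a \<otimes> b \<otimes> b \<otimes> a \<otimes> (b \<otimes> b)"
proof -
  have "c = b \<otimes> b \<otimes> a \<otimes> b \<otimes> (b \<otimes> a)" unfolding z_alt by (simp add: m_assoc)
  also have "\<dots> = b \<otimes> a \<otimes> b \<otimes> a \<otimes> (b \<otimes> a)"
    by (simp add: m_assoc)
  also have "\<dots> = a \<otimes> b \<otimes> b \<otimes> a \<otimes> (b \<otimes> b)"
    by (simp add: m_assoc)
  finally show ?thesis .
qed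

lemma c_eq: "c = b \<otimes> a \<otimes> b \<otimes> (b \<otimes> a \<otimes> b)"
  unfolding c_alt by (simp add: m_assoc)

text \<open>By \<open>c_eq\<close>, \<open>c\<close> is the square of the half twist
  \<open>D = b a b\<close>. Conjugation by \<open>D\<close> exchanges \<open>a\<close> and
  \<open>b\<close>, so its square fixes both.\<close>

lemma c_commute: "c \<otimes> a = a \<otimes> c" "c \<otimes> b = b \<otimes> c"
proof -
  define D where "D = b \<otimes> a \<otimes> b"
  have D: "D \<in> carrier G" "D \<otimes> a = b \<otimes> D" "D \<otimes> b = a \<otimes> D"
    by (simp_all add: D_def m_assoc)
  have c: "c = D \<otimes> D" unfolding c_eq D_def ..
  have "c \<otimes> a = D \<otimes> (b \<otimes> D)" unfolding c using D by (simp add: m_assoc)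
  also have "\<dots> = a \<otimes> D \<otimes> D" using D by (simp flip: m_assoc)
  finally show "c \<otimes> a = a \<otimes> c" unfolding c using D by (simp add: m_assoc)
  have "c \<otimes> b = D \<otimes> (a \<otimes> D)" unfolding c using D by (simp add: m_assoc)
  also have "\<dots> = b \<otimes> D \<otimes> D" using D by (simp flip: m_assoc)
  finally show "c \<otimes> b = b \<otimes> c" unfolding c using D by (simp add: m_assoc)
qed

lemma abba: "a \<otimes> b \<otimes> b \<otimes> a = c \<otimes> inv (b \<otimes> b)"
  unfolding c_alt by (rule inv_solve_right[THEN iffD2]) simp_all

lemma ab_conj_pow: "a \<otimes> b \<otimes> (a \<otimes> a) [^] (k::int) = (b \<otimes> b) [^] k \<otimes> (a \<otimes> b)"
proof -
  have "b \<otimes> b = a \<otimes> b \<otimes> (a \<otimes> a) \<otimes> inv (a \<otimes> b)"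
    by (simp add: m_assoc inv_mult_group)
  hence "(b \<otimes> b) [^] k = a \<otimes> b \<otimes> (a \<otimes> a) [^] k \<otimes> inv (a \<otimes> b)"
    using conj_int_pow[of "a \<otimes> b" "a \<otimes> a" k] by simp
  thus ?thesis by (simp add: m_assoc inv_mult_group)
qed

text \<open>This is \<open>abba\<close> conjugated by \<open>a\<close>. Powers of the right-hand
  side are easy to control, since \<open>c\<close> commutes with \<open>b\<close>.\<close>

lemma xy_conj: "a \<otimes> a \<otimes> (b \<otimes> b) = a \<otimes> (c \<otimes> inv (b \<otimes> b)) \<otimes> inv a"
  unfolding abba [symmetric] by (simp add: m_assoc)

text \<open>Put \<open>S = a x^m\<close> and \<open>T = inv f b y^m f\<close>. The left-hand side is
  \<open>S S T T\<close>, the conjugate of \<open>(S T)(T S)\<close> by \<open>S\<close>. The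
  hexagons turn \<open>(S T)(T S)\<close> into \<open>inv f w^(2m+1) f\<close> with
  \<open>w = c inv y\<close>, and \<open>x y\<close> is the conjugate of \<open>w\<close> by
  \<open>a\<close>. The total conjugator \<open>S (inv f) (inv a)\<close> equals \<open>g\<close>, a
  power of \<open>x\<close> times a conjugate of \<open>inv f\<close>.\<close>

lemma hexagon_conj:
  fixes m :: int
  defines "x \<equiv> a \<otimes> a" and "y \<equiv> b \<otimes> b"
  assumes f [simp]: "f \<in> carrier G"
    and h1: "a \<otimes> x [^] m \<otimes> inv f \<otimes> b \<otimes> y [^] m \<otimes> f = inv f \<otimes> a \<otimes> b \<otimes> x [^] (- m) \<otimes> c [^] m"
    and h2: "inv f \<otimes> b \<otimes> y [^] m \<otimes> f \<otimes> a \<otimes> x [^] m = b \<otimes> a \<otimes> y [^] (- m) \<otimes> c [^] m \<otimes> f"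
  defines "g \<equiv> x [^] m \<otimes> (a \<otimes> inv f \<otimes> inv a)"
  shows "x [^] (2 * m + 1) \<otimes> (inv f \<otimes> y [^] (2 * m + 1) \<otimes> f)
     = g \<otimes> (x \<otimes> y) [^] (2 * m + 1) \<otimes> inv g"
proof -
  \<comment> \<open>An opaque name keeps the simplifier from expanding and rearranging the word
    abbreviated by \<open>c\<close>.\<close>
  define d where "d = c"
  have d [simp]: "d \<in> carrier G" unfolding d_def by simp
  have [simp]: "x \<in> carrier G" "y \<in> carrier G" by (simp_all add: x_def y_def)
  define S where "S = a \<otimes> x [^] m"
  define T where "T = inv f \<otimes> (b \<otimes> y [^] m) \<otimes> f"
  define w where "w = d \<otimes> inv y"
  have [simp]: "S \<in> carrier G" "T \<in> carrier G" "w \<in> carrier G" by (simp_all add: S_def T_def w_def)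
  have da: "d \<otimes> a = a \<otimes> d" and db: "d \<otimes> b = b \<otimes> d"
    unfolding d_def by (rule c_commute)+
  have dba: "d [^] m \<otimes> (b \<otimes> a) = b \<otimes> a \<otimes> d [^] m" and dab: "d [^] m \<otimes> (a \<otimes> b) = a \<otimes> b \<otimes> d [^] m"
    by (intro int_pow_commute commute_mult da db d a b m_closed)+
  have dy: "d \<otimes> y = y \<otimes> d"
    unfolding y_def by (intro commute_mult db d b)
  hence dy': "d \<otimes> inv y = inv y \<otimes> d"
    by (metis \<open>y \<in> carrier G\<close> d inv_closed inv_solve_left' inv_solve_right' m_assoc m_closed)
  have wm: "d [^] m \<otimes> y [^] (- m) = w [^] m"
    unfolding w_def by (simp add: int_pow_mult_distrib[OF dy'] int_pow_inv int_pow_neg)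
  have wm': "y [^] (- m) \<otimes> d [^] m = w [^] m"
    unfolding w_def dy' by (simp add: int_pow_mult_distrib[OF dy'[symmetric]] int_pow_inv int_pow_neg)
  have SS: "S \<otimes> S = x [^] (2 * m + 1)"
    unfolding S_def x_def by (rule int_pow_odd) simp
  have TT: "T \<otimes> T = inv f \<otimes> y [^] (2 * m + 1) \<otimes> f"
  proof -
    have "T \<otimes> T = inv f \<otimes> (b \<otimes> y [^] m \<otimes> (b \<otimes> y [^] m)) \<otimes> f"
      unfolding T_def by (simp add: m_assoc)
    also have "b \<otimes> y [^] m \<otimes> (b \<otimes> y [^] m) = y [^] (2 * m + 1)"
      unfolding y_def by (rule int_pow_odd) simp
    finally show ?thesis .
  qed
  have ST: "S \<otimes> T = inv f \<otimes> (a \<otimes> b \<otimes> x [^] (- m) \<otimes> d [^] m)"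
    using h1 [folded d_def] by (simp add: S_def T_def m_assoc)
  have TS: "T \<otimes> S = b \<otimes> a \<otimes> y [^] (- m) \<otimes> d [^] m \<otimes> f"
    using h2 [folded d_def] by (simp add: S_def T_def m_assoc)
  have abX: "a \<otimes> b \<otimes> x [^] (- m) = y [^] (- m) \<otimes> (a \<otimes> b)"
    unfolding x_def y_def by (rule ab_conj_pow)
  have w: "a \<otimes> b \<otimes> (b \<otimes> a) = w"
    unfolding w_def d_def y_def abba [symmetric] by (simp add: m_assoc)
  \<comment> \<open>After \<open>abX\<close>, all factors between \<open>inv f\<close> and
    \<open>f\<close> combine to powers of \<open>w\<close>: the power of \<open>d\<close> slides
    left past \<open>a b\<close>, and the middle letters \<open>a b b a\<close> are \<open>w\<close>
    itself.\<close>
  have "S \<otimes> T \<otimes> (T \<otimes> S)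
      = inv f \<otimes> (y [^] (- m) \<otimes> (a \<otimes> b \<otimes> d [^] m) \<otimes> (b \<otimes> a) \<otimes> (y [^] (- m) \<otimes> d [^] m)) \<otimes> f"
    unfolding ST TS abX by (simp add: m_assoc del: aba abaz)
  also have "\<dots> = inv f \<otimes> (y [^] (- m) \<otimes> d [^] m \<otimes> (a \<otimes> b \<otimes> (b \<otimes> a)) \<otimes> (y [^] (- m) \<otimes> d [^] m)) \<otimes> f"
    unfolding dab [symmetric] by (simp add: m_assoc del: aba abaz)
  also have "\<dots> = inv f \<otimes> (w [^] m \<otimes> w \<otimes> w [^] m) \<otimes> f"
    unfolding w wm' ..
  also have "w [^] m \<otimes> w \<otimes> w [^] m = w [^] (2 * m + 1)"
  proof -
    have "w [^] m \<otimes> w = w [^] (m + 1)" using int_pow_mult[of w m 1] by simp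
    thus ?thesis by (simp add: int_pow_mult [symmetric] algebra_simps)
  qed
  finally have STTS: "S \<otimes> T \<otimes> (T \<otimes> S) = inv f \<otimes> w [^] (2 * m + 1) \<otimes> f" .
  have xy: "(x \<otimes> y) [^] (2 * m + 1) = a \<otimes> w [^] (2 * m + 1) \<otimes> inv a"
  proof -
    have "x \<otimes> y = a \<otimes> w \<otimes> inv a"
      unfolding x_def y_def w_def d_def by (rule xy_conj)
    thus ?thesis by (simp add: conj_int_pow)
  qed
  have ax: "a \<otimes> x [^] m = x [^] m \<otimes> a"
    by (rule int_pow_commute[symmetric]) (simp_all add: x_def m_assoc)
  have "S \<otimes> S \<otimes> (T \<otimes> T) = S \<otimes> (S \<otimes> T \<otimes> (T \<otimes> S)) \<otimes> inv S"
    by (simp add: m_assoc)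
  also have "\<dots> = g \<otimes> (a \<otimes> w [^] (2 * m + 1) \<otimes> inv a) \<otimes> inv g"
    unfolding STTS unfolding g_def S_def ax by (simp add: m_assoc inv_mult_group)
  finally show ?thesis unfolding SS TT xy .
qed

end

section \<open>The subgroup generated by \<open>a a\<close>, \<open>b b\<close> and
  \<open>z\<close>, and representatives of its cosets\<close>

lemma (in group) generate_conj_closed:
  assumes g: "g \<in> carrier G" and S: "S \<subseteq> carrier G"
    and gen: "\<And>s. s \<in> S \<Longrightarrow> g \<otimes> s \<otimes> inv g \<in> generate G S"
    and h: "h \<in> generate G S"
  shows "g \<otimes> h \<otimes> inv g \<in> generate G S"
  using h
proof (induction rule: generate.induct)
  case one
  then show ?case using g by (simp add: generate.one)
next
  case (incl h)
  then show ?case by (rule gen)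
next
  case (inv h)
  have "inv (g \<otimes> h \<otimes> inv g) \<in> generate G S"
    using gen[OF inv] generate_m_inv_closed[OF S] by blast
  moreover have "h \<in> carrier G" using inv S by blast
  ultimately show ?case using g by (simp add: inv_mult_group m_assoc)
next
  case (eng h1 h2)
  have "h1 \<in> carrier G" "h2 \<in> carrier G" using eng generate_in_carrier[OF S] by blast+
  hence "g \<otimes> (h1 \<otimes> h2) \<otimes> inv g = g \<otimes> h1 \<otimes> inv g \<otimes> (g \<otimes> h2 \<otimes> inv g)"
    using g by (simp add: m_assoc)
  then show ?case using eng generate.eng by metis
qed

lemma set_multI: "h \<in> A \<Longrightarrow> k \<in> B \<Longrightarrow> u = h \<otimes>\<^bsub>G\<^esub> k \<Longrightarrow> u \<in> A <#>\<^bsub>G\<^esub> B"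
  by (auto simp: set_mult_def)

lemma set_multE:
  assumes "u \<in> A <#>\<^bsub>G\<^esub> B"
  obtains h k where "h \<in> A" "k \<in> B" "u = h \<otimes>\<^bsub>G\<^esub> k"
  using assms by (auto simp: set_mult_def)

context braid_pair
begin

abbreviation H where "H \<equiv> generate G {a \<otimes> a, b \<otimes> b, z}"

lemma H_gens: "a \<otimes> a \<in> H" "b \<otimes> b \<in> H" "z \<in> H"
  by (auto intro: generate.incl)

lemma H_subgroup: "subgroup H G"
  by (rule generate_is_subgroup) auto

lemma a_conj_y: "a \<otimes> (b \<otimes> b) \<otimes> inv a = inv (b \<otimes> b) \<otimes> z \<otimes> (b \<otimes> b)"
proof -
  have "a \<otimes> (b \<otimes> b) \<otimes> inv a = (a \<otimes> b \<otimes> inv a) \<otimes> (a \<otimes> b \<otimes> inv a)"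
    by (simp add: m_assoc)
  thus ?thesis unfolding conj_a by (simp add: m_assoc inv_mult_group)
qed

lemma conj_z:
  "a \<otimes> z \<otimes> inv a = b \<otimes> b"
  "inv a \<otimes> z \<otimes> a = z \<otimes> (b \<otimes> b) \<otimes> inv z"
  "b \<otimes> z \<otimes> inv b = b \<otimes> b \<otimes> (a \<otimes> a) \<otimes> inv (b \<otimes> b)"
  "inv b \<otimes> z \<otimes> b = a \<otimes> a"
proof -
  show "a \<otimes> z \<otimes> inv a = b \<otimes> b" unfolding z_alt by (simp add: m_assoc)
  have conj: "inv (inv a \<otimes> p \<otimes> a) \<otimes> (inv a \<otimes> q \<otimes> a) \<otimes> (inv a \<otimes> p \<otimes> a) = inv a \<otimes> (inv p \<otimes> q \<otimes> p) \<otimes> a"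
    if "p \<in> carrier G" "q \<in> carrier G" for p q
    using that by (simp add: m_assoc inv_mult_group)
  \<comment> \<open>Conjugate \<open>a_conj_y\<close> by \<open>inv a\<close>: by
    \<open>z_alt\<close> this turns \<open>b b\<close> into \<open>z\<close>, and the resulting
    equation can be solved for the conjugate of \<open>z\<close>.\<close>
  have "inv z \<otimes> (inv a \<otimes> z \<otimes> a) \<otimes> z = inv a \<otimes> (a \<otimes> (b \<otimes> b) \<otimes> inv a) \<otimes> a"
    unfolding a_conj_y using conj[of "b \<otimes> b" z] unfolding z_alt [symmetric] by simp
  also have "\<dots> = b \<otimes> b" by (simp add: m_assoc)
  finally have *: "inv z \<otimes> (inv a \<otimes> z \<otimes> a) \<otimes> z = b \<otimes> b" .
  have "p = q \<otimes> (inv q \<otimes> p \<otimes> q) \<otimes> inv q" if "p \<in> carrier G" "q \<in> carrier G" for p q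
    using that by (simp add: m_assoc)
  from this[of "inv a \<otimes> z \<otimes> a" z] show "inv a \<otimes> z \<otimes> a = z \<otimes> (b \<otimes> b) \<otimes> inv z"
    unfolding * by simp
qed (simp_all add: m_assoc inv_mult_group)

text \<open>It suffices to treat the three generators of \<open>H\<close>; the facts in
  \<open>eqs\<close> write each of their conjugates as a word in those generators.\<close>

lemma H_conj:
  assumes "g \<in> {a, inv a, b, inv b}" "h \<in> H"
  shows "g \<otimes> h \<otimes> inv g \<in> H"
proof (rule generate_conj_closed)
  note [intro] = subgroup.m_closed[OF H_subgroup] subgroup.m_inv_closed[OF H_subgroup] H_gens
  fix s assume s: "s \<in> {a \<otimes> a, b \<otimes> b, z}"
  have "a \<otimes> (a \<otimes> a) \<otimes> inv a = a \<otimes> a" "inv a \<otimes> (a \<otimes> a) \<otimes> a = a \<otimes> a"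
    "b \<otimes> (b \<otimes> b) \<otimes> inv b = b \<otimes> b" "inv b \<otimes> (b \<otimes> b) \<otimes> b = b \<otimes> b"
    "inv b \<otimes> (a \<otimes> a) \<otimes> b = inv (b \<otimes> b) \<otimes> z \<otimes> (b \<otimes> b)"
    by (simp_all add: m_assoc inv_mult_group)
  note eqs = this a_conj_y z_alt [symmetric] conj_z
  consider "g = a" | "g = inv a" | "g = b" | "g = inv b" using assms(1) by blast
  thus "g \<otimes> s \<otimes> inv g \<in> H"
  proof cases
    case 1
    have "a \<otimes> s \<otimes> inv a \<in> H" using s by (elim insertE emptyE) (simp_all only: eqs, blast+)
    thus ?thesis using 1 by simp
  next
    case 2
    have "inv a \<otimes> s \<otimes> a \<in> H" using s by (elim insertE emptyE) (simp_all only: eqs, blast+)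
    thus ?thesis using 2 by simp
  next
    case 3
    have "b \<otimes> s \<otimes> inv b \<in> H" using s by (elim insertE emptyE) (simp_all only: eqs, blast+)
    thus ?thesis using 3 by simp
  next
    case 4
    have "inv b \<otimes> s \<otimes> b \<in> H" using s by (elim insertE emptyE) (simp_all only: eqs, blast+)
    thus ?thesis using 4 by simp
  qed
qed (use assms in auto)

text \<open>In \<open>B3\<close> these words induce the six permutations of three points. They serve
  as representatives of the cosets of \<open>H\<close>.\<close>

definition Tr where "Tr = {\<one>, a, b, a \<otimes> b, b \<otimes> a, a \<otimes> b \<otimes> a}"

lemma H_Tr_mult_a:
  assumes "t \<in> Tr"
  shows "a \<otimes> t \<in> H <#> Tr"
proof -
  have *: "a \<otimes> t = h \<otimes> t' \<Longrightarrow> h \<in> H \<Longrightarrow> t' \<in> Tr \<Longrightarrow> ?thesis" for h t'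
    by (rule set_multI)
  have o: "\<one> \<in> H" by (rule generate.one)
  from assms consider "t = \<one>" | "t = a" | "t = b" | "t = a \<otimes> b" | "t = b \<otimes> a" | "t = a \<otimes> b \<otimes> a"
    unfolding Tr_def by blast
  thus ?thesis
  proof cases
    case 1 show ?thesis by (rule *[OF _ o, of a]) (simp_all add: Tr_def 1)
  next
    case 2 show ?thesis by (rule *[OF _ H_gens(1), of \<one>]) (simp_all add: Tr_def 2)
  next
    case 3 show ?thesis by (rule *[OF _ o, of "a \<otimes> b"]) (simp_all add: Tr_def 3)
  next
    case 4 show ?thesis by (rule *[OF _ H_gens(1), of b]) (simp_all add: Tr_def 4 m_assoc)
  next
    case 5 show ?thesis by (rule *[OF _ o, of "a \<otimes> b \<otimes> a"]) (simp_all add: Tr_def 5 m_assoc)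
  next
    case 6 show ?thesis by (rule *[OF _ H_gens(1), of "b \<otimes> a"]) (simp_all add: Tr_def 6 m_assoc del: aba)
  qed
qed

lemma H_Tr_mult_b:
  assumes "t \<in> Tr"
  shows "b \<otimes> t \<in> H <#> Tr"
proof -
  have *: "b \<otimes> t = h \<otimes> t' \<Longrightarrow> h \<in> H \<Longrightarrow> t' \<in> Tr \<Longrightarrow> ?thesis" for h t'
    by (rule set_multI)
  have o: "\<one> \<in> H" by (rule generate.one)
  from assms consider "t = \<one>" | "t = a" | "t = b" | "t = a \<otimes> b" | "t = b \<otimes> a" | "t = a \<otimes> b \<otimes> a"
    unfolding Tr_def by blast
  thus ?thesis
  proof cases
    case 1 show ?thesis by (rule *[OF _ o, of b]) (simp_all add: Tr_def 1)
  next
    case 2 show ?thesis by (rule *[OF _ o, of "b \<otimes> a"]) (simp_all add: Tr_def 2)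
  next
    case 3 show ?thesis by (rule *[OF _ H_gens(2), of \<one>]) (simp_all add: Tr_def 3)
  next
    case 4 show ?thesis by (rule *[OF _ o, of "a \<otimes> b \<otimes> a"]) (simp_all add: Tr_def 4 m_assoc)
  next
    case 5 show ?thesis by (rule *[OF _ H_gens(2), of a]) (simp_all add: Tr_def 5 m_assoc)
  next
    case 6 show ?thesis by (rule *[OF _ H_gens(2), of "a \<otimes> b"]) (simp_all add: Tr_def 6 m_assoc)
  qed
qed

text \<open>For a generator \<open>e\<close>, write \<open>e h t = (e h inv e)(e t)\<close>: the
  first factor is in \<open>H\<close> by \<open>H_conj\<close>, the second is covered by the two
  tables above. An inverse letter is reduced to a positive one through
  \<open>inv a = inv (a a) a\<close>, where \<open>inv (a a)\<close> lies in
  \<open>H\<close>.\<close>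

lemma H_Tr_closed:
  assumes "g \<in> {a, inv a, b, inv b}" "u \<in> H <#> Tr"
  shows "g \<otimes> u \<in> H <#> Tr"
proof -
  note Hc = subgroup.mem_carrier[OF H_subgroup] and Hm = subgroup.m_closed[OF H_subgroup]
  have Tr: "t \<in> carrier G" if "t \<in> Tr" for t using that by (auto simp: Tr_def)
  have pos: "e \<otimes> v \<in> H <#> Tr" if e: "e \<in> {a, b}" and v: "v \<in> H <#> Tr" for e v
  proof -
    from v obtain h t where h: "h \<in> H" and t: "t \<in> Tr" and v: "v = h \<otimes> t"
      by (rule set_multE)
    have e': "e \<in> carrier G" using e by auto
    have "e \<otimes> t \<in> H <#> Tr" using e H_Tr_mult_a[OF t] H_Tr_mult_b[OF t] by blast
    then obtain h' t' where h': "h' \<in> H" and t': "t' \<in> Tr" and eq: "e \<otimes> t = h' \<otimes> t'"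
      by (rule set_multE)
    have "e \<otimes> v = (e \<otimes> h \<otimes> inv e) \<otimes> (e \<otimes> t)"
      unfolding v using Hc[OF h] Tr[OF t] e' by (simp add: m_assoc)
    also have "\<dots> = (e \<otimes> h \<otimes> inv e \<otimes> h') \<otimes> t'"
      unfolding eq using Hc[OF h] Hc[OF h'] Tr[OF t'] e' by (simp add: m_assoc)
    finally have eq': "e \<otimes> v = (e \<otimes> h \<otimes> inv e \<otimes> h') \<otimes> t'" .
    have "e \<otimes> h \<otimes> inv e \<in> H" using H_conj[OF _ h, of e] e by blast
    from Hm[OF this h'] t' eq' show ?thesis by (rule set_multI)
  qed
  have H_mult: "h \<otimes> v \<in> H <#> Tr" if h: "h \<in> H" and v: "v \<in> H <#> Tr" for h v
  proof -
    from v obtain h' t where *: "h' \<in> H" "t \<in> Tr" "v = h' \<otimes> t"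
      by (rule set_multE)
    have "h \<otimes> v = (h \<otimes> h') \<otimes> t"
      unfolding *(3) using Hc[OF h] Hc[OF *(1)] Tr[OF *(2)] by (simp add: m_assoc)
    with Hm[OF h *(1)] *(2) show ?thesis by (rule set_multI)
  qed
  have u: "u \<in> carrier G"
    using assms(2) Tr Hc by (elim set_multE) simp
  have sq: "inv (a \<otimes> a) \<in> H" "inv (b \<otimes> b) \<in> H" using subgroup.m_inv_closed[OF H_subgroup] H_gens by blast+
  have "inv a \<otimes> u = inv (a \<otimes> a) \<otimes> (a \<otimes> u)" "inv b \<otimes> u = inv (b \<otimes> b) \<otimes> (b \<otimes> u)"
    using u by (simp_all add: m_assoc inv_mult_group)
  hence "inv a \<otimes> u \<in> H <#> Tr" "inv b \<otimes> u \<in> H <#> Tr"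
    using H_mult[OF sq(1) pos[OF _ assms(2), of a]] H_mult[OF sq(2) pos[OF _ assms(2), of b]]
    by (metis insertI1 insertI2)+
  thus ?thesis using assms pos[of a u] pos[of b u] by blast
qed

end

section \<open>Braid groups and generators of the pure braid group\<close>

declare One_nat_def [simp del]

abbreviation braid_class :: "nat \<Rightarrow> braid_word \<Rightarrow> braid" where
  "braid_class n w \<equiv> braid_rel n `` {w}"

lemma braid_words_Cons [simp]:
  "l # w \<in> braid_words n \<longleftrightarrow> fst l \<in> {1..<n} \<and> w \<in> braid_words n"
  by (cases l) (auto simp: braid_words_def)

lemma one_braid_group: "\<one>\<^bsub>braid_group n\<^esub> = braid_class n []"
  by (simp add: braid_group_def)

lemma sigma_closed [simp]: "1 \<le> i \<Longrightarrow> i < n \<Longrightarrow> sigma n i \<in> carrier (braid_group n)"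
  unfolding sigma_def by (rule braid_class_in_carrier) (simp add: Nil_in_braid_words)

lemma braid_class_eqI: "braid_eq n u v \<Longrightarrow> braid_class n u = braid_class n v"
  using braid_eq_words braid_class_eq_iff by blast

lemma inv_sigma:
  assumes "1 \<le> i" "i < n"
  shows "inv\<^bsub>braid_group n\<^esub> (sigma n i) = braid_class n [(i, False)]"
proof (rule group.inv_equality[OF group_braid_group])
  have "braid_class n [(i, False), (i, True)] = braid_class n []"
    using braid_eq.cancel[OF assms, of False] by (intro braid_class_eqI) simp
  thus "braid_class n [(i, False)] \<otimes>\<^bsub>braid_group n\<^esub> sigma n i = \<one>\<^bsub>braid_group n\<^esub>"
    using assms by (simp add: sigma_def one_braid_group braid_class_mult Nil_in_braid_words)
qed (use assms in \<open>simp_all add: braid_class_in_carrier Nil_in_braid_words\<close>)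

lemma braid_class_append:
  "u \<in> braid_words n \<Longrightarrow> v \<in> braid_words n \<Longrightarrow>
    braid_class n (u @ v) = braid_class n u \<otimes>\<^bsub>braid_group n\<^esub> braid_class n v"
  by (simp add: braid_class_mult)

lemma braid_class_Cons:
  assumes "1 \<le> i" "i < n" "w \<in> braid_words n"
  shows "braid_class n ((i, e) # w) =
    (if e then sigma n i else inv\<^bsub>braid_group n\<^esub> (sigma n i)) \<otimes>\<^bsub>braid_group n\<^esub> braid_class n w"
  using braid_class_append[of "[(i, e)]" n w] assms
  by (cases e) (simp_all add: Nil_in_braid_words flip: inv_sigma sigma_def)

lemma sigma_far:
  assumes "1 \<le> i" "i + 2 \<le> j" "j < n"
  shows "sigma n i \<otimes>\<^bsub>braid_group n\<^esub> sigma n j = sigma n j \<otimes>\<^bsub>braid_group n\<^esub> sigma n i"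
  using braid_class_eqI[OF braid_eq.far[OF assms]] assms
  by (simp add: sigma_def braid_class_mult Nil_in_braid_words)

lemma braid_pair_sigma:
  assumes "1 \<le> i" "i + 1 < n"
  shows "braid_pair (braid_group n) (sigma n i) (sigma n (i + 1))"
proof -
  interpret group "braid_group n" by (rule group_braid_group)
  show ?thesis
    using braid_class_eqI[OF braid_eq.braid[OF assms]] assms
    by unfold_locales (simp_all add: sigma_def braid_class_mult braid_class_in_carrier Nil_in_braid_words)
qed

lemma group_hom_braid_perm: "group_hom (braid_group n) (sym_group n) braid_perm"
  by (intro group_hom.intro group_hom_axioms.intro group_braid_group sym_group_is_group braid_perm_hom)

lemma braid_perm_mult:
  "g \<in> carrier (braid_group n) \<Longrightarrow> h \<in> carrier (braid_group n) \<Longrightarrow>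
    braid_perm (g \<otimes>\<^bsub>braid_group n\<^esub> h) = braid_perm g \<circ> braid_perm h"
  using hom_mult[OF braid_perm_hom] by (simp add: sym_group_mult)

lemma braid_perm_sigma:
  "1 \<le> i \<Longrightarrow> i < n \<Longrightarrow> braid_perm (sigma n i) = transpose i (Suc i)"
  by (simp add: sigma_def braid_perm_class Nil_in_braid_words)

lemma PB_normal: "PB n \<lhd> braid_group n"
  unfolding PB_def by (rule group_hom.normal_kernel[OF group_hom_braid_perm])

lemma PB_subgroup: "subgroup (PB n) (braid_group n)"
  by (rule normal_imp_subgroup[OF PB_normal])

lemma PB_iff: "g \<in> PB n \<longleftrightarrow> g \<in> carrier (braid_group n) \<and> braid_perm g = id"
  by (simp add: PB_def kernel_def sym_group_one)

lemma group_PB_group: "group (PB_group n)"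
  unfolding PB_group_def by (rule subgroup.subgroup_is_group[OF PB_subgroup group_braid_group])

lemma PB_group_simps [simp]:
  "carrier (PB_group n) = PB n"
  "monoid.mult (PB_group n) = monoid.mult (braid_group n)"
  "monoid.one (PB_group n) = monoid.one (braid_group n)"
  by (simp_all add: PB_group_def)

lemma sigma_conjugator_closed:
  assumes "1 \<le> i" "j \<le> n"
  shows "sigma_conjugator n i j \<in> carrier (braid_group n)"
proof -
  interpret group "braid_group n" by (rule group_braid_group)
  have "foldr (\<otimes>\<^bsub>braid_group n\<^esub>) (map (sigma n) l) \<one>\<^bsub>braid_group n\<^esub> \<in> carrier (braid_group n)"
    if "set l \<subseteq> {1..<n}" for l
    using that by (induction l) auto
  thus ?thesis using assms unfolding sigma_conjugator_def by auto
qed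

lemma pure_gen_in_PB:
  assumes "1 \<le> i" "i < j" "j \<le> n"
  shows "pure_gen n i j \<in> PB n"
proof -
  interpret group "braid_group n" by (rule group_braid_group)
  have s: "sigma n i \<in> carrier (braid_group n)" using assms by simp
  have c: "sigma_conjugator n i j \<in> carrier (braid_group n)"
    using assms by (intro sigma_conjugator_closed) simp_all
  have "sigma n i [^]\<^bsub>braid_group n\<^esub> (2::nat) = braid_class n [(i, True), (i, True)]"
    using assms s by (simp add: numeral_2_eq_2 sigma_def braid_class_mult Nil_in_braid_words)
  moreover have "braid_class n [(i, True), (i, True)] \<in> PB n"
    unfolding PB_iff using assms
    by (auto simp: braid_class_in_carrier braid_perm_class Nil_in_braid_words fun_eq_iff transpose_def)
  ultimately show ?thesis
    unfolding pure_gen_def by (simp add: normal.inv_op_closed2[OF PB_normal c])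
qed

lemma pure_gen_simps:
  assumes "1 \<le> i"
  shows "i + 1 \<le> n \<Longrightarrow> pure_gen n i (i + 1) = sigma n i \<otimes>\<^bsub>braid_group n\<^esub> sigma n i"
    and "i + 2 \<le> n \<Longrightarrow> pure_gen n i (i + 2) = sigma n (i + 1) \<otimes>\<^bsub>braid_group n\<^esub>
      (sigma n i \<otimes>\<^bsub>braid_group n\<^esub> sigma n i) \<otimes>\<^bsub>braid_group n\<^esub> inv\<^bsub>braid_group n\<^esub> (sigma n (i + 1))"
    and "i + 3 \<le> n \<Longrightarrow> pure_gen n i (i + 3) = sigma n (i + 2) \<otimes>\<^bsub>braid_group n\<^esub> sigma n (i + 1)
      \<otimes>\<^bsub>braid_group n\<^esub> (sigma n i \<otimes>\<^bsub>braid_group n\<^esub> sigma n i)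
      \<otimes>\<^bsub>braid_group n\<^esub> inv\<^bsub>braid_group n\<^esub> (sigma n (i + 2) \<otimes>\<^bsub>braid_group n\<^esub> sigma n (i + 1))"
proof -
  interpret group "braid_group n" by (rule group_braid_group)
  have *: "[Suc i..<i + 1] = []" "[Suc i..<i + 2] = [i + 1]" "[Suc i..<i + 3] = [i + 1, i + 2]"
    by (simp_all add: upt_rec)
  show "i + 1 \<le> n \<Longrightarrow> pure_gen n i (i + 1) = sigma n i \<otimes>\<^bsub>braid_group n\<^esub> sigma n i"
    using assms by (simp add: pure_gen_def sigma_conjugator_def * numeral_2_eq_2)
  show "i + 2 \<le> n \<Longrightarrow> pure_gen n i (i + 2) = sigma n (i + 1) \<otimes>\<^bsub>braid_group n\<^esub>
      (sigma n i \<otimes>\<^bsub>braid_group n\<^esub> sigma n i) \<otimes>\<^bsub>braid_group n\<^esub> inv\<^bsub>braid_group n\<^esub> (sigma n (i + 1))"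
    using assms unfolding pure_gen_def sigma_conjugator_def *
    by (simp add: numeral_2_eq_2)
  show "i + 3 \<le> n \<Longrightarrow> pure_gen n i (i + 3) = sigma n (i + 2) \<otimes>\<^bsub>braid_group n\<^esub> sigma n (i + 1)
      \<otimes>\<^bsub>braid_group n\<^esub> (sigma n i \<otimes>\<^bsub>braid_group n\<^esub> sigma n i)
      \<otimes>\<^bsub>braid_group n\<^esub> inv\<^bsub>braid_group n\<^esub> (sigma n (i + 2) \<otimes>\<^bsub>braid_group n\<^esub> sigma n (i + 1))"
    using assms unfolding pure_gen_def sigma_conjugator_def *
    by (simp add: numeral_2_eq_2)
qed

abbreviation s1 where "s1 \<equiv> sigma 3 1"
abbreviation s2 where "s2 \<equiv> sigma 3 2"

interpretation B3: braid_pair B3 s1 s2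
  using braid_pair_sigma[of 1 3] by simp

lemma pure_gen_3:
  "x12 = s1 \<otimes>\<^bsub>B3\<^esub> s1" "x23 = s2 \<otimes>\<^bsub>B3\<^esub> s2"
  "x13 = s2 \<otimes>\<^bsub>B3\<^esub> (s1 \<otimes>\<^bsub>B3\<^esub> s1) \<otimes>\<^bsub>B3\<^esub> inv\<^bsub>B3\<^esub> s2"
  using pure_gen_simps[of 1 3] pure_gen_simps(1)[of 2 3]
  by (simp_all add: numeral_eq_Suc)

lemma pure_gens_3_in_PB: "x12 \<in> PB 3" "x23 \<in> PB 3" "x13 \<in> PB 3"
  by (simp_all add: pure_gen_in_PB)

lemma central_in_PB: "central \<in> PB 3"
  unfolding central_def using pure_gens_3_in_PB subgroup.m_closed[OF PB_subgroup] by metis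

lemma B3_in_H_Tr: "w \<in> braid_words 3 \<Longrightarrow> braid_class 3 w \<in> B3.H <#>\<^bsub>B3\<^esub> B3.Tr"
proof (induction w)
  case Nil
  show ?case
    by (rule set_multI[of "\<one>\<^bsub>B3\<^esub>" _ "\<one>\<^bsub>B3\<^esub>"])
      (simp_all add: B3.Tr_def generate.one flip: one_braid_group)
next
  case (Cons l w)
  obtain i e where l: "l = (i, e)" by (cases l)
  have w: "w \<in> braid_words 3" and i: "i = 1 \<or> i = 2" using Cons.prems by (auto simp: l)
  have eq: "braid_class 3 (l # w) = (if e then sigma 3 i else inv\<^bsub>B3\<^esub> (sigma 3 i)) \<otimes>\<^bsub>B3\<^esub> braid_class 3 w"
    using i w unfolding l by (intro braid_class_Cons) auto
  have "(if e then sigma 3 i else inv\<^bsub>B3\<^esub> (sigma 3 i)) \<in> {s1, inv\<^bsub>B3\<^esub> s1, s2, inv\<^bsub>B3\<^esub> s2}"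
    using i by auto
  from B3.H_Tr_closed[OF this Cons.IH[OF w]] show ?case unfolding eq .
qed

text \<open>A pure braid is \<open>h t\<close> with \<open>h\<close> in \<open>H\<close> and
  \<open>t\<close> in \<open>Tr\<close>. Since \<open>h\<close> is pure, so is \<open>t\<close>, and
  the only element of \<open>Tr\<close> inducing the identity permutation is \<open>\<one>\<close>.
  This makes homomorphisms on \<open>PB 3\<close> determined by three values.\<close>

lemma PB3_generated: "PB 3 = generate B3 {x12, x23, x13}"
proof
  have sub: "generate B3 {x12, x23, x13} \<subseteq> PB 3"
    using pure_gens_3_in_PB by (intro B3.generate_subgroup_incl[OF _ PB_subgroup]) auto
  thus "generate B3 {x12, x23, x13} \<subseteq> PB 3" .
  show "PB 3 \<subseteq> generate B3 {x12, x23, x13}"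
  proof
    fix g assume g: "g \<in> PB 3"
    hence gc: "g \<in> carrier B3" by (simp add: PB_iff)
    then obtain w where "w \<in> braid_words 3" "g = braid_class 3 w" by (rule braid_carrierE)
    from B3_in_H_Tr[OF this(1)] this(2) obtain h t where
      h: "h \<in> generate B3 {x12, x23, x13}" and t: "t \<in> B3.Tr" and eq: "g = h \<otimes>\<^bsub>B3\<^esub> t"
      unfolding pure_gen_3 by (auto elim: set_multE)
    have hP: "h \<in> PB 3" using h sub by blast
    hence hc: "h \<in> carrier B3" by (simp add: PB_iff)
    have tc: "t \<in> carrier B3" using t by (auto simp: B3.Tr_def)
    have "t = inv\<^bsub>B3\<^esub> h \<otimes>\<^bsub>B3\<^esub> g" using eq hc tc by simp
    hence "t \<in> PB 3" using g hP subgroup.m_closed[OF PB_subgroup] subgroup.m_inv_closed[OF PB_subgroup] by metis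
    hence tp: "braid_perm t = id" by (simp add: PB_iff)
    have "t = \<one>\<^bsub>B3\<^esub>"
    proof (rule ccontr)
      assume "t \<noteq> \<one>\<^bsub>B3\<^esub>"
      then consider "t = s1" | "t = s2" | "t = s1 \<otimes>\<^bsub>B3\<^esub> s2" | "t = s2 \<otimes>\<^bsub>B3\<^esub> s1"
        | "t = s1 \<otimes>\<^bsub>B3\<^esub> s2 \<otimes>\<^bsub>B3\<^esub> s1"
        using t unfolding B3.Tr_def by blast
      \<comment> \<open>The points 1 and 2 suffice: a permutation of three points that fixes both is
        the identity.\<close>
      hence "braid_perm t 1 \<noteq> 1 \<or> braid_perm t 2 \<noteq> 2"
        by cases (simp_all add: braid_perm_sigma braid_perm_mult transpose_def B3.m_assoc del: B3.aba)
      with tp show False by simp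
    qed
    thus "g \<in> generate B3 {x12, x23, x13}" using eq h hc by simp
  qed
qed

section \<open>Doubling a strand\<close>

lemma (in braid_pair) abba_alt: "a \<otimes> b \<otimes> (b \<otimes> a) = a \<otimes> a \<otimes> z"
  unfolding z_alt by (simp add: m_assoc)

text \<open>Three consecutive Artin generators. Here \<open>c\<close> is the third generator, not
  the central element that \<open>c\<close> abbreviates in \<open>braid_pair\<close>.\<close>

locale braid_triple = braid_pair +
  fixes c
  assumes c3 [simp]: "c \<in> carrier G"
    and braid': "b \<otimes> c \<otimes> b = c \<otimes> b \<otimes> c"
    and far: "a \<otimes> c = c \<otimes> a"
begin

lemma far_left: "u \<in> carrier G \<Longrightarrow> c \<otimes> (a \<otimes> u) = a \<otimes> (c \<otimes> u)"
  by (metis a c3 far m_assoc)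

text \<open>This and the next two lemmas are the braid relation after doubling the first, second or
  third of its three strands. They are the cases \<open>p = k\<close>, \<open>p = k + 1\<close> and
  \<open>p = k + 2\<close> in \<open>cable_word_cong\<close>.\<close>

lemma cable_braid_0: "b \<otimes> a \<otimes> (c \<otimes> b) \<otimes> a = c \<otimes> (b \<otimes> a) \<otimes> (c \<otimes> b)"
proof -
  have "b \<otimes> a \<otimes> (c \<otimes> b) \<otimes> a = b \<otimes> c \<otimes> (a \<otimes> b \<otimes> a)"
    by (simp add: m_assoc far_left del: aba)
  also have "\<dots> = b \<otimes> c \<otimes> b \<otimes> (a \<otimes> b)" by (simp add: m_assoc)
  also have "\<dots> = c \<otimes> (b \<otimes> a) \<otimes> (c \<otimes> b)"
    unfolding braid' by (simp add: m_assoc far_left)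
  finally show ?thesis .
qed

lemma cable_braid_1: "a \<otimes> b \<otimes> c \<otimes> (b \<otimes> a) = c \<otimes> b \<otimes> a \<otimes> (b \<otimes> c)"
proof -
  have "a \<otimes> b \<otimes> c \<otimes> (b \<otimes> a) = a \<otimes> (b \<otimes> c \<otimes> b) \<otimes> a" by (simp add: m_assoc)
  also have "\<dots> = (a \<otimes> c) \<otimes> b \<otimes> (c \<otimes> a)" unfolding braid' by (simp add: m_assoc)
  also have "\<dots> = c \<otimes> (a \<otimes> b \<otimes> a) \<otimes> c" by (simp add: m_assoc far_left far [symmetric] del: aba abaz)
  finally show ?thesis by (simp add: m_assoc)
qed

lemma cable_braid_2: "a \<otimes> (b \<otimes> c) \<otimes> (a \<otimes> b) = b \<otimes> c \<otimes> (a \<otimes> b) \<otimes> c"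
proof -
  have "a \<otimes> (b \<otimes> c) \<otimes> (a \<otimes> b) = a \<otimes> b \<otimes> a \<otimes> (c \<otimes> b)"
    by (simp add: m_assoc far_left del: aba abaz)
  also have "\<dots> = b \<otimes> a \<otimes> (b \<otimes> c \<otimes> b)" by (simp add: m_assoc)
  finally show ?thesis unfolding braid' by (simp add: m_assoc far_left)
qed

text \<open>For \<open>a, b, c\<close> the generators of \<open>B4\<close> this identifies the value
  at \<open>x13\<close> of the doubling of the third strand with \<open>x13 x14\<close>. Moving
  \<open>c\<close> past \<open>a\<close> and applying \<open>braid'\<close> gathers the right-hand
  side into a conjugate of \<open>a a z\<close>, which is \<open>a b b a\<close> by
  \<open>abba_alt\<close>.\<close>

lemma cable_x13:
  "b \<otimes> c \<otimes> (a \<otimes> b \<otimes> (b \<otimes> a)) \<otimes> inv (b \<otimes> c)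
    = z \<otimes> (c \<otimes> b \<otimes> (a \<otimes> a) \<otimes> inv (c \<otimes> b))"
proof -
  have 1: "inv b \<otimes> c \<otimes> b = c \<otimes> b \<otimes> inv c"
    by (metis b braid' c3 inv_closed inv_solve_left' inv_solve_right m_assoc m_closed)
  have 2: "inv c \<otimes> inv b \<otimes> inv c = inv b \<otimes> inv c \<otimes> inv b"
    using arg_cong[OF braid', of "m_inv G"] by (simp add: inv_mult_group m_assoc)
  have 3: "inv c \<otimes> (a \<otimes> u) = a \<otimes> (inv c \<otimes> u)" if "u \<in> carrier G" for u
    using that by (metis a c3 far_left inv_closed inv_solve_left m_closed)
  have "z \<otimes> (c \<otimes> b \<otimes> (a \<otimes> a) \<otimes> inv (c \<otimes> b))
      = b \<otimes> (a \<otimes> a) \<otimes> (inv b \<otimes> c \<otimes> b) \<otimes> (a \<otimes> a) \<otimes> (inv b \<otimes> inv c)"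
    by (simp add: m_assoc inv_mult_group)
  also have "\<dots> = b \<otimes> c \<otimes> (a \<otimes> a \<otimes> b \<otimes> (a \<otimes> a)) \<otimes> (inv c \<otimes> inv b \<otimes> inv c)"
    unfolding 1 by (simp add: m_assoc far_left 3 del: aba abaz)
  also have "\<dots> = b \<otimes> c \<otimes> (a \<otimes> a \<otimes> z) \<otimes> inv (b \<otimes> c)"
    unfolding 2 by (simp add: m_assoc inv_mult_group del: aba abaz)
  finally show ?thesis unfolding abba_alt ..
qed

end

lemma braid_triple_sigma:
  assumes "1 \<le> k" "k + 2 < n"
  shows "braid_triple (braid_group n) (sigma n k) (sigma n (k + 1)) (sigma n (k + 2))"
proof -
  interpret P: braid_pair "braid_group n" "sigma n k" "sigma n (k + 1)"
    using assms by (intro braid_pair_sigma) simp_all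
  interpret Q: braid_pair "braid_group n" "sigma n (k + 1)" "sigma n (k + 2)"
    using braid_pair_sigma[of "k + 1" n] assms unfolding add.assoc one_add_one by simp
  show ?thesis
    using Q.braid sigma_far[of k "k + 2" n] assms by unfold_locales simp_all
qed

text \<open>
  \<open>cable n p\<close> doubles the strand at position \<open>p\<close> of a braid on \<open>n\<close> strands; for \<open>p = 0\<close> and
  \<open>p = n + 1\<close> a strand is added on the left and on the right instead.  Words are read from left to
  right and the doubled strand is followed through the word, so \<open>cable\<close> is a crossed homomorphism
  on the braid group and a homomorphism on the pure braid group.  For \<open>n = 3\<close> and \<open>p = 0, \<dots>, 4\<close> these
  are \<open>phi_234\<close>, \<open>phi_12_3_4\<close>, \<open>phi_1_23_4\<close>, \<open>phi_1_2_34\<close>, \<open>phi_123\<close>.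
\<close>

definition cable_sigma :: "nat \<Rightarrow> nat \<Rightarrow> nat \<Rightarrow> braid" where
  "cable_sigma n p k =
    (if p < k then sigma (n + 1) (k + 1)
     else if p = k then sigma (n + 1) (k + 1) \<otimes>\<^bsub>braid_group (n + 1)\<^esub> sigma (n + 1) k
     else if p = k + 1 then sigma (n + 1) k \<otimes>\<^bsub>braid_group (n + 1)\<^esub> sigma (n + 1) (k + 1)
     else sigma (n + 1) k)"

text \<open>\<open>q\<close> is the position of the followed strand after the letter. An inverse
  letter uses \<open>cable_sigma\<close> at \<open>q\<close> rather than \<open>p\<close>, because
  following the strand through a letter and back must give the trivial braid.\<close>

primrec cable_word :: "nat \<Rightarrow> nat \<Rightarrow> braid_word \<Rightarrow> braid" where
  "cable_word n p [] = \<one>\<^bsub>braid_group (n + 1)\<^esub>"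
| "cable_word n p (l # w) =
    (let k = fst l; q = transpose k (Suc k) p in
      (if snd l then cable_sigma n p k else inv\<^bsub>braid_group (n + 1)\<^esub> (cable_sigma n q k))
      \<otimes>\<^bsub>braid_group (n + 1)\<^esub> cable_word n q w)"

lemma cable_sigma_closed [simp]:
  assumes "1 \<le> k" "k < n"
  shows "cable_sigma n p k \<in> carrier (braid_group (n + 1))"
proof -
  interpret group "braid_group (n + 1)" by (rule group_braid_group)
  show ?thesis using assms by (simp add: cable_sigma_def)
qed

lemma cable_word_closed [simp]:
  "w \<in> braid_words n \<Longrightarrow> cable_word n p w \<in> carrier (braid_group (n + 1))"
proof (induction w arbitrary: p)
  interpret group "braid_group (n + 1)" by (rule group_braid_group)
  { case Nil show ?case by simp }
  { case (Cons l w) then show ?case by (auto simp: Let_def) }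
qed

lemma inv_word_perm_Cons:
  "inv' (word_perm (l # w)) p = inv' (word_perm w) (transpose (fst l) (Suc (fst l)) p)"
proof -
  have "bij (word_perm w)" for w
    by (induction w) (simp_all only: word_perm.simps bij_id bij_comp bij_transpose)
  thus ?thesis by (simp add: o_inv_distrib)
qed

text \<open>The strand meets the letters from left to right, whereas \<open>word_perm\<close>
  composes them as functions, applying the last letter first. Hence the position reached after
  \<open>u\<close> is given by the inverse permutation.\<close>

lemma cable_word_append:
  "u \<in> braid_words n \<Longrightarrow> v \<in> braid_words n \<Longrightarrow> cable_word n p (u @ v) =
    cable_word n p u \<otimes>\<^bsub>braid_group (n + 1)\<^esub> cable_word n (inv' (word_perm u) p) v"
proof (induction u arbitrary: p)
  interpret group "braid_group (n + 1)" by (rule group_braid_group)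
  { case Nil then show ?case by (simp add: inv_id[unfolded id_def] id_def) }
  { case (Cons l u)
    then show ?case
      by (auto simp: Let_def inv_word_perm_Cons m_assoc simp del: word_perm.simps) }
qed

text \<open>Doubling respects Artin's relations, so it descends to braids. In each relation the
  followed strand either takes part in a crossing or passes beside all of them, and the cases run
  through its possible positions.\<close>

lemma cable_word_cong:
  assumes "braid_eq n u v"
  shows "cable_word n p u = cable_word n p v"
  using assms
proof (induction arbitrary: p rule: braid_eq.induct)
  case (append u u' v v')
  then show ?case
    using braid_eq_words[OF append.hyps(1)] braid_eq_words[OF append.hyps(2)]
      braid_eq_word_perm[OF append.hyps(1)] by (simp add: cable_word_append)
next
  interpret group "braid_group (n + 1)" by (rule group_braid_group)
  case (cancel i b)
  then show ?case by (cases b) (simp_all add: Let_def)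
next
  interpret group "braid_group (n + 1)" by (rule group_braid_group)
  let ?s = "sigma (n + 1)"
  case (far i j)
  have [simp]: "1 \<le> i" "1 \<le> j" "i < n" "j < n" "i + 1 < n" "i < n + 1" "j < n + 1" using far by linarith+
  have cl: "?s i \<in> carrier (braid_group (n + 1))" "?s (i + 1) \<in> carrier (braid_group (n + 1))"
    "?s j \<in> carrier (braid_group (n + 1))" "?s (j + 1) \<in> carrier (braid_group (n + 1))"
    using far by simp_all
  \<comment> \<open>The generators with indices \<open>i + 1\<close> and \<open>j\<close> may be
    neighbours, but they never meet: the first occurs only for \<open>p \<le> i + 1\<close>, the
    second only for \<open>p \<ge> j\<close>.\<close>
  have f: "?s i \<otimes>\<^bsub>braid_group (n + 1)\<^esub> ?s j = ?s j \<otimes>\<^bsub>braid_group (n + 1)\<^esub> ?s i"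
    "?s i \<otimes>\<^bsub>braid_group (n + 1)\<^esub> ?s (j + 1) = ?s (j + 1) \<otimes>\<^bsub>braid_group (n + 1)\<^esub> ?s i"
    "?s (i + 1) \<otimes>\<^bsub>braid_group (n + 1)\<^esub> ?s (j + 1) = ?s (j + 1) \<otimes>\<^bsub>braid_group (n + 1)\<^esub> ?s (i + 1)"
    by (rule sigma_far; use far in linarith)+
  note comm = f commute_mult[OF f(1,2)] commute_mult[OF f(2,1)]
    commute_mult[OF f(2,3)[symmetric]] commute_mult[OF f(3,2)[symmetric]]
  consider "p < i" | "p = i" | "p = i + 1" | "i + 1 < p" "p < j" | "p = j" | "p = j + 1" | "j + 1 < p"
    by linarith
  then show ?case
    by cases (use far cl in \<open>simp_all add: Let_def cable_sigma_def transpose_def comm\<close>)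
next
  case (braid k)
  interpret T: braid_triple "braid_group (n + 1)" "sigma (n + 1) k" "sigma (n + 1) (k + 1)" "sigma (n + 1) (k + 2)"
    using braid by (intro braid_triple_sigma) simp_all
  consider "p < k" | "p = k" | "p = k + 1" | "p = k + 2" | "k + 2 < p"
    by linarith
  then show ?case
    using T.braid T.braid' T.cable_braid_0 T.cable_braid_1 T.cable_braid_2 T.a T.b T.c3
    by cases (simp_all add: Let_def cable_sigma_def transpose_def add.assoc T.m_assoc del: T.aba T.abaz T.abbab T.abbabz)
qed (simp_all)

definition cable :: "nat \<Rightarrow> nat \<Rightarrow> braid \<Rightarrow> braid" where
  "cable n p g = the_elem (cable_word n p ` g)"

lemma cable_class:
  assumes "w \<in> braid_words n"
  shows "cable n p (braid_class n w) = cable_word n p w"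
proof -
  have "cable_word n p ` braid_class n w = {cable_word n p w}"
    using braid_eq.refl[OF assms] by (auto simp: braid_rel_def dest: cable_word_cong)
  thus ?thesis by (simp add: cable_def)
qed

lemma cable_closed [simp]:
  "g \<in> carrier (braid_group n) \<Longrightarrow> cable n p g \<in> carrier (braid_group (n + 1))"
  by (elim braid_carrierE) (simp add: cable_class)

lemma cable_one: "cable n p \<one>\<^bsub>braid_group n\<^esub> = \<one>\<^bsub>braid_group (n + 1)\<^esub>"
  by (simp add: one_braid_group cable_class Nil_in_braid_words)

lemma cable_mult:
  assumes "g \<in> carrier (braid_group n)" "h \<in> carrier (braid_group n)"
  shows "cable n p (g \<otimes>\<^bsub>braid_group n\<^esub> h)
    = cable n p g \<otimes>\<^bsub>braid_group (n + 1)\<^esub> cable n (inv' (braid_perm g) p) h"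
  using assms
  by (elim braid_carrierE)
    (simp add: braid_class_mult cable_class append_in_braid_words cable_word_append braid_perm_class)

text \<open>After \<open>g\<close> the strand sits at position \<open>inv' (braid_perm g) p\<close>,
  and the pure braid \<open>h\<close> leaves it there; the way back through the inverse of
  \<open>g\<close> undoes \<open>cable n p g\<close>. So conjugation in the source permutes the
  doublings up to conjugation in the target, the key to \<open>N_PB3_normal\<close>.\<close>

lemma cable_conj:
  assumes g: "g \<in> carrier (braid_group n)" and h: "h \<in> PB n"
  shows "cable n p (g \<otimes>\<^bsub>braid_group n\<^esub> h \<otimes>\<^bsub>braid_group n\<^esub> inv\<^bsub>braid_group n\<^esub> g)
    = cable n p g \<otimes>\<^bsub>braid_group (n + 1)\<^esub> cable n (inv' (braid_perm g) p) h
      \<otimes>\<^bsub>braid_group (n + 1)\<^esub> inv\<^bsub>braid_group (n + 1)\<^esub> (cable n p g)"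
proof -
  interpret B: group "braid_group n" by (rule group_braid_group)
  interpret C: group "braid_group (n + 1)" by (rule group_braid_group)
  have h': "h \<in> carrier (braid_group n)" "braid_perm h = id" using h by (simp_all add: PB_iff)
  have gi: "inv\<^bsub>braid_group n\<^esub> g \<in> carrier (braid_group n)" using g by simp
  have gh: "g \<otimes>\<^bsub>braid_group n\<^esub> h \<in> carrier (braid_group n)" using g h' by simp
  have perm: "braid_perm (g \<otimes>\<^bsub>braid_group n\<^esub> h) = braid_perm g"
    using hom_mult[OF braid_perm_hom g h'(1)] h'(2) by (simp add: sym_group_mult)
  have "cable n p g \<otimes>\<^bsub>braid_group (n + 1)\<^esub> cable n (inv' (braid_perm g) p) (inv\<^bsub>braid_group n\<^esub> g)
      = \<one>\<^bsub>braid_group (n + 1)\<^esub>"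
    using cable_mult[OF g gi, of p] g by (simp add: cable_one)
  hence "cable n (inv' (braid_perm g) p) (inv\<^bsub>braid_group n\<^esub> g) = inv\<^bsub>braid_group (n + 1)\<^esub> (cable n p g)"
    using g gi by (metis C.inv_equality C.inv_inv C.inv_closed cable_closed)
  thus ?thesis by (simp add: cable_mult[OF gh gi] cable_mult[OF g h'(1)] perm)
qed

lemma cable_sigma:
  assumes "1 \<le> k" "k < n"
  shows "cable n p (sigma n k) = cable_sigma n p k"
proof -
  interpret group "braid_group (n + 1)" by (rule group_braid_group)
  show ?thesis using assms by (simp add: sigma_def cable_class Nil_in_braid_words Let_def)
qed

lemma cable_hom: "cable n p \<in> hom (PB_group n) (braid_group (n + 1))"
proof (rule homI)
  fix g h assume "g \<in> carrier (PB_group n)" "h \<in> carrier (PB_group n)"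
  thus "cable n p (g \<otimes>\<^bsub>PB_group n\<^esub> h) = cable n p g \<otimes>\<^bsub>braid_group (n + 1)\<^esub> cable n p h"
    by (simp add: PB_iff cable_mult)
qed (simp add: PB_iff)

section \<open>The five homomorphisms from \<open>PB 3\<close> to \<open>PB 4\<close> as strand
  doublings, and the normality of \<open>N_PB3 N\<close>\<close>

abbreviation t1 where "t1 \<equiv> sigma 4 1"
abbreviation t2 where "t2 \<equiv> sigma 4 2"
abbreviation t3 where "t3 \<equiv> sigma 4 3"

interpretation B4: braid_triple B4 t1 t2 t3
  using braid_triple_sigma[of 1 4] by (simp add: numeral_eq_Suc One_nat_def)

lemma pure_gen_4:
  "pure_gen 4 1 2 = t1 \<otimes>\<^bsub>B4\<^esub> t1" "pure_gen 4 2 3 = t2 \<otimes>\<^bsub>B4\<^esub> t2" "pure_gen 4 3 4 = t3 \<otimes>\<^bsub>B4\<^esub> t3"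
  "pure_gen 4 1 3 = t2 \<otimes>\<^bsub>B4\<^esub> (t1 \<otimes>\<^bsub>B4\<^esub> t1) \<otimes>\<^bsub>B4\<^esub> inv\<^bsub>B4\<^esub> t2"
  "pure_gen 4 2 4 = t3 \<otimes>\<^bsub>B4\<^esub> (t2 \<otimes>\<^bsub>B4\<^esub> t2) \<otimes>\<^bsub>B4\<^esub> inv\<^bsub>B4\<^esub> t3"
  "pure_gen 4 1 4 = t3 \<otimes>\<^bsub>B4\<^esub> t2 \<otimes>\<^bsub>B4\<^esub> (t1 \<otimes>\<^bsub>B4\<^esub> t1) \<otimes>\<^bsub>B4\<^esub> inv\<^bsub>B4\<^esub> (t3 \<otimes>\<^bsub>B4\<^esub> t2)"
  using pure_gen_simps[of 1 4] pure_gen_simps(1,2)[of 2 4] pure_gen_simps(1)[of 3 4]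
  by simp_all

lemma cable_3_gens:
  "cable 3 p x12 = cable_sigma 3 p 1 \<otimes>\<^bsub>B4\<^esub> cable_sigma 3 (transpose 1 2 p) 1"
  "cable 3 p x23 = cable_sigma 3 p 2 \<otimes>\<^bsub>B4\<^esub> cable_sigma 3 (transpose 2 3 p) 2"
  "cable 3 p x13 = cable_sigma 3 p 2 \<otimes>\<^bsub>B4\<^esub> cable 3 (transpose 2 3 p) x12 \<otimes>\<^bsub>B4\<^esub> inv\<^bsub>B4\<^esub> (cable_sigma 3 p 2)"
proof -
  show "cable 3 p x12 = cable_sigma 3 p 1 \<otimes>\<^bsub>B4\<^esub> cable_sigma 3 (transpose 1 2 p) 1"
    "cable 3 p x23 = cable_sigma 3 p 2 \<otimes>\<^bsub>B4\<^esub> cable_sigma 3 (transpose 2 3 p) 2"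
    unfolding pure_gen_3 by (simp_all add: cable_mult cable_sigma braid_perm_sigma)
  show "cable 3 p x13 = cable_sigma 3 p 2 \<otimes>\<^bsub>B4\<^esub> cable 3 (transpose 2 3 p) x12 \<otimes>\<^bsub>B4\<^esub> inv\<^bsub>B4\<^esub> (cable_sigma 3 p 2)"
    unfolding pure_gen_3(3) pure_gen_3(1) [symmetric]
    by (simp add: cable_conj pure_gens_3_in_PB cable_sigma braid_perm_sigma)
qed

lemma cable_gens_values:
  "cable 3 4 x12 = pure_gen 4 1 2" "cable 3 4 x23 = pure_gen 4 2 3" "cable 3 4 x13 = pure_gen 4 1 3"
  "cable 3 0 x12 = pure_gen 4 2 3" "cable 3 0 x23 = pure_gen 4 3 4" "cable 3 0 x13 = pure_gen 4 2 4"
  "cable 3 1 x12 = pure_gen 4 1 3 \<otimes>\<^bsub>B4\<^esub> pure_gen 4 2 3" "cable 3 1 x23 = pure_gen 4 3 4"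
  "cable 3 1 x13 = pure_gen 4 1 4 \<otimes>\<^bsub>B4\<^esub> pure_gen 4 2 4"
  "cable 3 2 x12 = pure_gen 4 1 2 \<otimes>\<^bsub>B4\<^esub> pure_gen 4 1 3"
  "cable 3 2 x23 = pure_gen 4 2 4 \<otimes>\<^bsub>B4\<^esub> pure_gen 4 3 4" "cable 3 2 x13 = pure_gen 4 1 4"
  "cable 3 3 x12 = pure_gen 4 1 2" "cable 3 3 x23 = pure_gen 4 2 3 \<otimes>\<^bsub>B4\<^esub> pure_gen 4 2 4"
  "cable 3 3 x13 = pure_gen 4 1 3 \<otimes>\<^bsub>B4\<^esub> pure_gen 4 1 4"
proof -
  interpret T: braid_pair B4 t2 t3
    using braid_pair_sigma[of 2 4] by simp
  note word = cable_sigma_def transpose_def pure_gen_4 B4.m_assoc B4.inv_mult_group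
  show "cable 3 4 x12 = pure_gen 4 1 2" "cable 3 4 x23 = pure_gen 4 2 3" "cable 3 4 x13 = pure_gen 4 1 3"
    "cable 3 0 x12 = pure_gen 4 2 3" "cable 3 0 x23 = pure_gen 4 3 4" "cable 3 0 x13 = pure_gen 4 2 4"
    "cable 3 1 x12 = pure_gen 4 1 3 \<otimes>\<^bsub>B4\<^esub> pure_gen 4 2 3" "cable 3 1 x23 = pure_gen 4 3 4"
    "cable 3 1 x13 = pure_gen 4 1 4 \<otimes>\<^bsub>B4\<^esub> pure_gen 4 2 4"
    "cable 3 2 x23 = pure_gen 4 2 4 \<otimes>\<^bsub>B4\<^esub> pure_gen 4 3 4" "cable 3 2 x13 = pure_gen 4 1 4"
    "cable 3 3 x12 = pure_gen 4 1 2"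
    unfolding cable_3_gens by (simp_all add: word del: B4.aba B4.abaz)
  \<comment> \<open>In the three remaining cases the doubled strand produces a word of the form
    \<open>a b b a\<close> or a conjugate of it, which has to be split into two pure
    generators.\<close>
  show "cable 3 2 x12 = pure_gen 4 1 2 \<otimes>\<^bsub>B4\<^esub> pure_gen 4 1 3"
    unfolding cable_3_gens pure_gen_4 B4.abba_alt [symmetric]
    by (simp add: cable_sigma_def transpose_def)
  show "cable 3 3 x23 = pure_gen 4 2 3 \<otimes>\<^bsub>B4\<^esub> pure_gen 4 2 4"
    unfolding cable_3_gens pure_gen_4 T.abba_alt [symmetric]
    by (simp add: cable_sigma_def transpose_def)
  show "cable 3 3 x13 = pure_gen 4 1 3 \<otimes>\<^bsub>B4\<^esub> pure_gen 4 1 4"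
    unfolding cable_3_gens pure_gen_4 B4.cable_x13 [symmetric]
    by (simp add: cable_sigma_def transpose_def)
qed

lemma hom_eq_on_generate:
  assumes "group G" "group H" "S \<in> hom G H" "T \<in> hom G H" "A \<subseteq> carrier G"
    and "\<And>a. a \<in> A \<Longrightarrow> S a = T a" and "g \<in> generate G A"
  shows "S g = T g"
proof -
  interpret S: group_hom G H S using assms by (simp add: group_hom_def group_hom_axioms_def)
  interpret T: group_hom G H T using assms by (simp add: group_hom_def group_hom_axioms_def)
  show ?thesis
    using assms(7)
  proof (induction rule: generate.induct)
    case (inv h)
    then show ?case using assms(5,6) by (metis S.hom_inv T.hom_inv subsetD)
  next
    case (eng h k)
    then show ?case using S.G.generate_in_carrier[OF assms(5)] by simp
  qed (use assms(6) in simp_all)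
qed

lemma PB3_generated_PB: "PB 3 = generate (PB_group 3) {x12, x23, x13}"
  using B3.generate_consistent[OF _ PB_subgroup, of "{x12, x23, x13}"] pure_gens_3_in_PB
  by (simp add: PB3_generated [symmetric] PB_group_def)

text \<open>\<open>T\<close> shows that the choice in \<open>PB3_hom\<close> has a solution; since
  three elements generate \<open>PB 3\<close>, any solution agrees with \<open>T\<close>
  there.\<close>

lemma PB3_hom_eq:
  assumes T: "T \<in> hom (PB_group 3) (PB_group 4)" "T x12 = a" "T x23 = b" "T x13 = c"
    and g: "g \<in> PB 3"
  shows "PB3_hom a b c g = T g"
proof -
  let ?S = "PB3_hom a b c" and ?A = "{x12, x23, x13}"
  have S: "?S \<in> hom (PB_group 3) (PB_group 4) \<and> ?S x12 = a \<and> ?S x23 = b \<and> ?S x13 = c"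
    unfolding PB3_hom_def by (rule someI[of _ T]) (use T in simp)
  show ?thesis
  proof (rule hom_eq_on_generate[where A = ?A and S = ?S and T = T and g = g, OF group_PB_group group_PB_group])
    show "?S \<in> hom (PB_group 3) (PB_group 4)" using S by (rule conjunct1)
    show "T \<in> hom (PB_group 3) (PB_group 4)" by (rule T(1))
    show "?A \<subseteq> carrier (PB_group 3)" using pure_gens_3_in_PB by simp
    show "?S s = T s" if "s \<in> ?A" for s
      using that S T(2-4) by (elim insertE emptyE) metis+
    show "g \<in> generate (PB_group 3) ?A" using g unfolding PB3_generated_PB .
  qed
qed

text \<open>The values on the three generators are products of pure generators, and
  \<open>PB 4\<close> is a subgroup, so it contains the whole image.\<close>

lemma cable_PB: "cable 3 p \<in> hom (PB_group 3) (PB_group 4)" if "p \<le> 4" for p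
proof -
  have hom: "cable 3 p \<in> hom (PB_group 3) B4" using cable_hom[of 3 p] by simp
  interpret group_hom "PB_group 3" B4 "cable 3 p"
    by (intro group_hom.intro group_hom_axioms.intro group_PB_group group_braid_group hom)
  have "p = 0 \<or> p = 1 \<or> p = 2 \<or> p = 3 \<or> p = 4" using that by linarith
  hence "cable 3 p ` {x12, x23, x13} \<subseteq> PB 4"
    by (elim disjE)
      (simp_all add: cable_gens_values pure_gen_in_PB subgroup.m_closed[OF PB_subgroup])
  hence "generate B4 (cable 3 p ` {x12, x23, x13}) \<subseteq> PB 4"
    by (rule B4.generate_subgroup_incl[OF _ PB_subgroup])
  hence "cable 3 p ` PB 3 \<subseteq> PB 4"
    using generate_img[of "{x12, x23, x13}"] pure_gens_3_in_PB
    by (simp flip: PB3_generated_PB)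
  thus ?thesis using hom by (auto simp: hom_def)
qed

lemma phi_eq_cable:
  assumes "g \<in> PB 3"
  shows "phi_123 g = cable 3 4 g" "phi_234 g = cable 3 0 g" "phi_12_3_4 g = cable 3 1 g"
    "phi_1_23_4 g = cable 3 2 g" "phi_1_2_34 g = cable 3 3 g"
  unfolding phi_123_def phi_234_def phi_12_3_4_def phi_1_23_4_def phi_1_2_34_def
  by (intro PB3_hom_eq cable_PB cable_gens_values assms; simp)+

lemma N_PB3_cable: "N_PB3 N = {g \<in> PB 3. \<forall>p\<le>4. cable 3 p g \<in> N}"
proof -
  have "(\<forall>p\<le>4. cable 3 p g \<in> N) \<longleftrightarrow> (\<forall>p\<in>{0, 1, 2, 3, 4}. cable 3 p g \<in> N)" for g
  proof -
    have "{p::nat. p \<le> 4} = {0, 1, 2, 3, 4}" by auto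
    thus ?thesis by blast
  qed
  thus ?thesis unfolding N_PB3_def by (auto simp: phi_eq_cable)
qed

text \<open>On \<open>PB 3\<close> the doublings are homomorphisms, which gives a subgroup. By
  \<open>cable_conj\<close>, doubling a conjugate of \<open>h\<close> at \<open>p\<close> gives a
  conjugate in \<open>B4\<close> of \<open>h\<close> doubled at another position. As
  \<open>N\<close> is normal in \<open>B4\<close> and all positions from 0 to 4 are required, the
  condition is invariant.\<close>

lemma N_PB3_normal:
  assumes N: "N \<lhd> B4"
  shows "N_PB3 N \<lhd> B3"
proof -
  interpret N: normal N B4 by (rule N)
  have hom: "cable 3 p \<in> hom (PB_group 3) B4" for p using cable_hom[of 3 p] by simp
  interpret cable: group_hom "PB_group 3" B4 "cable 3 p" for p
    by (intro group_hom.intro group_hom_axioms.intro group_PB_group group_braid_group hom)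
  have inv_PB: "inv\<^bsub>PB_group 3\<^esub> g = inv\<^bsub>B3\<^esub> g" if "g \<in> PB 3" for g
    using B3.m_inv_consistent[OF PB_subgroup that] by (simp add: PB_group_def)
  have sub: "subgroup (N_PB3 N) B3"
  proof (rule B3.subgroupI)
    show "N_PB3 N \<subseteq> carrier B3" by (auto simp: N_PB3_def PB_iff)
    have "\<one>\<^bsub>B3\<^esub> \<in> N_PB3 N"
      using subgroup.one_closed[OF PB_subgroup] cable_one[of 3] by (simp add: N_PB3_cable)
    thus "N_PB3 N \<noteq> {}" by blast
    fix g assume g: "g \<in> N_PB3 N"
    thus "inv\<^bsub>B3\<^esub> g \<in> N_PB3 N"
      using cable.hom_inv[of g] subgroup.m_inv_closed[OF PB_subgroup, of g] inv_PB[of g]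
      by (simp add: N_PB3_cable)
    fix h assume h: "h \<in> N_PB3 N"
    with g show "g \<otimes>\<^bsub>B3\<^esub> h \<in> N_PB3 N"
      using cable.hom_mult[of g h] subgroup.m_closed[OF PB_subgroup, of g _ h]
      by (simp add: N_PB3_cable)
  qed
  show ?thesis
    unfolding B3.normal_inv_iff
  proof (intro conjI sub ballI)
    fix g h assume g: "g \<in> carrier B3" and h: "h \<in> N_PB3 N"
    have hP: "h \<in> PB 3" using h by (simp add: N_PB3_cable)
    have "cable 3 p (g \<otimes>\<^bsub>B3\<^esub> h \<otimes>\<^bsub>B3\<^esub> inv\<^bsub>B3\<^esub> g) \<in> N" if p: "p \<le> 4" for p
    proof -
      have "braid_perm g permutes {1..3}"
        using braid_perm_hom[of 3] g by (auto simp: hom_def sym_group_carrier)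
      hence "inv' (braid_perm g) permutes {1..3}" by (rule permutes_inv)
      \<comment> \<open>The permutation moves only the positions 1 to 3; the outer positions 0 and 4
        are fixed.\<close>
      hence "inv' (braid_perm g) p \<le> 4"
        using p permutes_in_image[of "inv' (braid_perm g)" "{1..3}" p]
        by (cases "p \<in> {1..3}") (auto simp: permutes_not_in)
      hence "cable 3 (inv' (braid_perm g) p) h \<in> N" using h by (simp add: N_PB3_cable)
      thus ?thesis
        using cable_conj[OF g hP, of p] N.inv_op_closed2 cable_closed[OF g, of p] by simp
    qed
    moreover have "g \<otimes>\<^bsub>B3\<^esub> h \<otimes>\<^bsub>B3\<^esub> inv\<^bsub>B3\<^esub> g \<in> PB 3"
      using normal.inv_op_closed2[OF PB_normal g hP] .
    ultimately show "g \<otimes>\<^bsub>B3\<^esub> h \<otimes>\<^bsub>B3\<^esub> inv\<^bsub>B3\<^esub> g \<in> N_PB3 N" by (simp add: N_PB3_cable)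
  qed
qed

section \<open>Cycle structures\<close>

lemma image_mset_mset_set_image_card:
  assumes "inj g"
  shows "image_mset card (mset_set ((`) g ` \<A>)) = image_mset card (mset_set \<A>)"
proof -
  have inj: "inj_on ((`) g) \<A>"
    using assms by (auto simp: inj_on_def inj_image_eq_iff)
  have "mset_set ((`) g ` \<A>) = image_mset ((`) g) (mset_set \<A>)"
    using image_mset_mset_set[OF inj] by simp
  moreover have "card (g ` X) = card X" for X
    using assms by (intro card_image) (auto simp: inj_on_def)
  ultimately show ?thesis by (simp add: multiset.map_comp comp_def)
qed

lemma cycle_structure_conj:
  assumes g: "g permutes {1..d}" and p: "p permutes {1..d}"
  shows "cycle_structure d (g \<circ> p \<circ> inv' g) = cycle_structure d p"
proof -
  \<comment> \<open>The inductive \<open>orbit p i\<close> starts at \<open>p i\<close>, so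
    \<open>i\<close> belongs to it only because the permutation returns to \<open>i\<close>.\<close>
  have self: "i \<in> orbit p i" for i
    using p by (intro permutation_self_in_orbit) (auto simp: permutation_permutes)
  have orb: "orbit (g \<circ> p \<circ> inv' g) (g i) = g ` orbit p i" for i
    using orbit_inverse[OF self, of i "g \<circ> p \<circ> inv' g" g] permutes_inverses(2)[OF g] by simp
  have "orbit (g \<circ> p \<circ> inv' g) ` {1..d} = orbit (g \<circ> p \<circ> inv' g) ` (g ` {1..d})"
    using permutes_image[OF g] by simp
  also have "\<dots> = (`) g ` (orbit p ` {1..d})"
    by (simp add: image_image orb)
  finally show ?thesis
    unfolding cycle_structure_def
    using image_mset_mset_set_image_card[OF permutes_inj[OF g]] by simp
qed

text \<open>Each element of the cyclic subgroup generated by \<open>p\<close> moves points along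
  orbits of \<open>p\<close>. Induction over \<open>generate\<close> treats positive and negative
  exponents together.\<close>

lemma orbit_int_pow_subset:
  assumes p: "p \<in> carrier (sym_group d)"
  shows "orbit (p [^]\<^bsub>sym_group d\<^esub> (j::int)) i \<subseteq> orbit p i"
proof -
  interpret group "sym_group d" by (rule sym_group_is_group)
  have perm: "permutation p" using p by (rule sym_group_carrier')
  have step: "q y \<in> orbit p y" if "q \<in> generate (sym_group d) {p}" for q y
    using that
  proof (induction arbitrary: y rule: generate.induct)
    case one
    then show ?case using permutation_self_in_orbit[OF perm] by (simp add: sym_group_one)
  next
    case (incl h)
    then show ?case by (auto intro: orbit.base)
  next
    case (inv h)
    then show ?case using p orbit.base[of "inv' p" y] orbit_inv_eq[OF perm, of y] by simp
  next
    case (eng h1 h2)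
    then show ?case by (auto simp: sym_group_mult intro: orbit_trans)
  qed
  have q: "p [^]\<^bsub>sym_group d\<^esub> j \<in> generate (sym_group d) {p}"
    unfolding generate_pow[OF p] by blast
  show ?thesis
  proof
    fix y assume "y \<in> orbit (p [^]\<^bsub>sym_group d\<^esub> j) i"
    thus "y \<in> orbit p i"
      by induction (auto intro: step[OF q] orbit_trans)
  qed
qed

text \<open>Here \<open>p\<close> and its \<open>k\<close>-th power are powers of each other, so
  they have the same orbits.\<close>

lemma cycle_structure_int_pow:
  assumes p: "p \<in> carrier (sym_group d)"
    and "p [^]\<^bsub>sym_group d\<^esub> (k * u :: int) = p"
  shows "cycle_structure d (p [^]\<^bsub>sym_group d\<^esub> k) = cycle_structure d p"
proof -
  interpret group "sym_group d" by (rule sym_group_is_group)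
  have "(p [^]\<^bsub>sym_group d\<^esub> k) [^]\<^bsub>sym_group d\<^esub> u = p"
    using assms by (simp add: int_pow_pow)
  hence "orbit (p [^]\<^bsub>sym_group d\<^esub> k) i = orbit p i" for i
    using orbit_int_pow_subset[OF p, of k i]
      orbit_int_pow_subset[of "p [^]\<^bsub>sym_group d\<^esub> k" d u i] p by simp
  thus ?thesis by (simp add: cycle_structure_def)
qed

lemma cycle_structure_conj_sym_group:
  assumes "g \<in> carrier (sym_group d)" "p \<in> carrier (sym_group d)"
  shows "cycle_structure d (g \<otimes>\<^bsub>sym_group d\<^esub> p \<otimes>\<^bsub>sym_group d\<^esub> inv\<^bsub>sym_group d\<^esub> g) = cycle_structure d p"
  using assms cycle_structure_conj by (simp add: sym_group_mult sym_group_carrier)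

section \<open>The free subgroup\<close>

lemma (in group) rcoset_eq_iff:
  assumes "subgroup H G" "x \<in> carrier G" "y \<in> carrier G"
  shows "H #> x = H #> y \<longleftrightarrow> x \<otimes> inv y \<in> H"
  using assms subgroup.rcos_module[OF assms(1) is_group assms(3,2)]
    repr_independence[of x H y] rcos_self[of x H] by metis

lemma (in group) generate_commute:
  assumes "c \<in> carrier G" "S \<subseteq> carrier G" "\<And>s. s \<in> S \<Longrightarrow> c \<otimes> s = s \<otimes> c" "g \<in> generate G S"
  shows "c \<otimes> g = g \<otimes> c"
  using assms(4)
proof (induction rule: generate.induct)
  case (inv s)
  have "s \<in> carrier G" using inv assms(2) by blast
  thus ?case using assms(1) assms(3)[OF inv]
    by (metis inv_closed inv_solve_left' inv_solve_right' m_assoc m_closed)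
next
  case (eng g h)
  then show ?case
    using commute_mult[of c g h] generate_in_carrier[OF assms(2)] assms(1) by blast
qed (use assms in simp_all)

lemma central_eq: "central = B3.c"
  unfolding central_def pure_gen_3 ..

lemma central_closed [simp]: "central \<in> carrier B3"
  using central_in_PB by (simp add: PB_iff)

lemma pure_gens_3_closed [simp]: "x12 \<in> carrier B3" "x23 \<in> carrier B3" "x13 \<in> carrier B3"
  using pure_gens_3_in_PB by (simp_all add: PB_iff)

lemma F2_subgroup: "subgroup F2 B3"
  unfolding F2_def by (rule B3.generate_is_subgroup) simp

lemma F2_gens: "x12 \<in> F2" "x23 \<in> F2"
  unfolding F2_def by (auto intro: generate.incl)

lemma F2_closed: "g \<in> F2 \<Longrightarrow> g \<in> carrier B3"
  by (rule subgroup.mem_carrier[OF F2_subgroup])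

lemma F2_int_pow: "g \<in> F2 \<Longrightarrow> g [^]\<^bsub>B3\<^esub> (k::int) \<in> F2"
  by (rule B3.subgroup_int_pow_closed[OF F2_subgroup])

lemmas F2_mult = subgroup.m_closed[OF F2_subgroup]
  and F2_inv = subgroup.m_inv_closed[OF F2_subgroup]

lemma F2_subset_PB: "F2 \<subseteq> PB 3"
  unfolding F2_def using pure_gens_3_in_PB
  by (intro B3.generate_subgroup_incl[OF _ PB_subgroup]) auto

lemma central_commute_F2:
  assumes "g \<in> F2"
  shows "central \<otimes>\<^bsub>B3\<^esub> g = g \<otimes>\<^bsub>B3\<^esub> central"
proof (rule B3.generate_commute)
  have "central \<otimes>\<^bsub>B3\<^esub> s1 = s1 \<otimes>\<^bsub>B3\<^esub> central" "central \<otimes>\<^bsub>B3\<^esub> s2 = s2 \<otimes>\<^bsub>B3\<^esub> central"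
    unfolding central_eq by (rule B3.c_commute)+
  thus "central \<otimes>\<^bsub>B3\<^esub> s = s \<otimes>\<^bsub>B3\<^esub> central" if "s \<in> {x12, x23}" for s
    using that unfolding pure_gen_3
    by (elim insertE emptyE) (simp_all only: B3.commute_mult central_closed B3.a B3.b)
qed (use assms in \<open>simp_all add: F2_def\<close>)

lemma central_pow_commute_F2:
  assumes "g \<in> F2"
  shows "central [^]\<^bsub>B3\<^esub> (j::int) \<otimes>\<^bsub>B3\<^esub> g = g \<otimes>\<^bsub>B3\<^esub> central [^]\<^bsub>B3\<^esub> j"
  using assms by (intro B3.int_pow_commute central_commute_F2) (simp_all add: F2_closed)

lemma x12_x23_conj:
  "x12 \<otimes>\<^bsub>B3\<^esub> x23 = s1 \<otimes>\<^bsub>B3\<^esub> (central \<otimes>\<^bsub>B3\<^esub> inv\<^bsub>B3\<^esub> x23) \<otimes>\<^bsub>B3\<^esub> inv\<^bsub>B3\<^esub> s1"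
  unfolding central_eq unfolding pure_gen_3 by (rule B3.xy_conj)

lemma central_commute_s1: "central \<otimes>\<^bsub>B3\<^esub> s1 = s1 \<otimes>\<^bsub>B3\<^esub> central"
  unfolding central_eq by (rule B3.c_commute)

text \<open>This solves \<open>x12_x23_conj\<close> for the conjugate of \<open>x23\<close>, using
  that \<open>central\<close> commutes with \<open>s1\<close>.\<close>

lemma s1_conj_x23:
  "s1 \<otimes>\<^bsub>B3\<^esub> x23 \<otimes>\<^bsub>B3\<^esub> inv\<^bsub>B3\<^esub> s1 = inv\<^bsub>B3\<^esub> (x12 \<otimes>\<^bsub>B3\<^esub> x23) \<otimes>\<^bsub>B3\<^esub> central"
proof -
  have *: "s1 \<otimes>\<^bsub>B3\<^esub> y \<otimes>\<^bsub>B3\<^esub> inv\<^bsub>B3\<^esub> s1 =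
      inv\<^bsub>B3\<^esub> (s1 \<otimes>\<^bsub>B3\<^esub> (c \<otimes>\<^bsub>B3\<^esub> inv\<^bsub>B3\<^esub> y) \<otimes>\<^bsub>B3\<^esub> inv\<^bsub>B3\<^esub> s1) \<otimes>\<^bsub>B3\<^esub> c"
    if "y \<in> carrier B3" "c \<in> carrier B3" "c \<otimes>\<^bsub>B3\<^esub> s1 = s1 \<otimes>\<^bsub>B3\<^esub> c" for y c
  proof -
    have "inv\<^bsub>B3\<^esub> s1 \<otimes>\<^bsub>B3\<^esub> c = c \<otimes>\<^bsub>B3\<^esub> inv\<^bsub>B3\<^esub> s1"
      using B3.generate_commute[of c "{s1}" "inv\<^bsub>B3\<^esub> s1"] that generate.inv[of s1 "{s1}" B3] by simp
    thus ?thesis using that by (simp add: B3.m_assoc B3.inv_mult_group)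
  qed
  show ?thesis
    unfolding x12_x23_conj by (rule *) (simp_all only: pure_gens_3_closed central_closed central_commute_s1)
qed

text \<open>It holds for the two generators, and the powers of \<open>central\<close> can be
  collected on the right because they commute with \<open>F2\<close>. The result is applied to the
  conjugator found in \<open>hexagon_conj\<close>.\<close>

lemma s1_conj_F2:
  assumes "f \<in> F2"
  shows "\<exists>v\<in>F2. \<exists>j::int. s1 \<otimes>\<^bsub>B3\<^esub> f \<otimes>\<^bsub>B3\<^esub> inv\<^bsub>B3\<^esub> s1 = v \<otimes>\<^bsub>B3\<^esub> central [^]\<^bsub>B3\<^esub> j"
proof -
  let ?C = "\<lambda>f. s1 \<otimes>\<^bsub>B3\<^esub> f \<otimes>\<^bsub>B3\<^esub> inv\<^bsub>B3\<^esub> s1"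
  let ?P = "\<lambda>f. \<exists>v\<in>F2. \<exists>j::int. ?C f = v \<otimes>\<^bsub>B3\<^esub> central [^]\<^bsub>B3\<^esub> j"
  have gens: "?P s" if "s \<in> {x12, x23}" for s
  proof -
    have "?C x12 = x12 \<otimes>\<^bsub>B3\<^esub> central [^]\<^bsub>B3\<^esub> (0::int)"
      unfolding pure_gen_3 by (simp add: B3.m_assoc)
    moreover have "?C x23 = inv\<^bsub>B3\<^esub> (x12 \<otimes>\<^bsub>B3\<^esub> x23) \<otimes>\<^bsub>B3\<^esub> central [^]\<^bsub>B3\<^esub> (1::int)"
      unfolding s1_conj_x23 by (simp only: B3.int_pow_1 central_closed)
    ultimately show ?thesis using that F2_gens F2_mult F2_inv by blast
  qed
  show ?thesis
    using assms unfolding F2_def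
  proof (induction rule: generate.induct)
    case one
    have "?C \<one>\<^bsub>B3\<^esub> = \<one>\<^bsub>B3\<^esub> \<otimes>\<^bsub>B3\<^esub> central [^]\<^bsub>B3\<^esub> (0::int)" by simp
    thus ?case using subgroup.one_closed[OF F2_subgroup] unfolding F2_def by blast
  next
    case (incl s)
    show ?case using gens[OF incl] unfolding F2_def .
  next
    case (inv s)
    from gens[OF inv] obtain v and j :: int
      where v: "v \<in> F2" "?C s = v \<otimes>\<^bsub>B3\<^esub> central [^]\<^bsub>B3\<^esub> j" by blast
    have sc: "s \<in> carrier B3" using inv by auto
    have "?C (inv\<^bsub>B3\<^esub> s) = inv\<^bsub>B3\<^esub> (?C s)"
      using sc by (simp add: B3.inv_mult_group B3.m_assoc)
    also have "\<dots> = central [^]\<^bsub>B3\<^esub> (- j) \<otimes>\<^bsub>B3\<^esub> inv\<^bsub>B3\<^esub> v"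
      unfolding v(2) using F2_closed[OF v(1)] by (simp add: B3.inv_mult_group B3.int_pow_neg)
    also have "\<dots> = inv\<^bsub>B3\<^esub> v \<otimes>\<^bsub>B3\<^esub> central [^]\<^bsub>B3\<^esub> (- j)"
      by (rule central_pow_commute_F2[OF F2_inv[OF v(1)]])
    finally show ?case using F2_inv[OF v(1)] unfolding F2_def by blast
  next
    case (eng f g)
    from eng.IH[folded F2_def] obtain u v and i j :: int where
      u: "u \<in> F2" "?C f = u \<otimes>\<^bsub>B3\<^esub> central [^]\<^bsub>B3\<^esub> i" and
      v: "v \<in> F2" "?C g = v \<otimes>\<^bsub>B3\<^esub> central [^]\<^bsub>B3\<^esub> j"
      by blast
    note c = eng.hyps[folded F2_def, THEN F2_closed] F2_closed[OF u(1)] F2_closed[OF v(1)]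
    have "?C (f \<otimes>\<^bsub>B3\<^esub> g) = ?C f \<otimes>\<^bsub>B3\<^esub> ?C g"
      using c by (simp add: B3.m_assoc)
    also have "\<dots> = u \<otimes>\<^bsub>B3\<^esub> (central [^]\<^bsub>B3\<^esub> i \<otimes>\<^bsub>B3\<^esub> v) \<otimes>\<^bsub>B3\<^esub> central [^]\<^bsub>B3\<^esub> j"
      unfolding u(2) v(2) using c by (simp add: B3.m_assoc)
    also have "\<dots> = u \<otimes>\<^bsub>B3\<^esub> v \<otimes>\<^bsub>B3\<^esub> central [^]\<^bsub>B3\<^esub> (i + j)"
      unfolding central_pow_commute_F2[OF v(1)] using c by (simp add: B3.m_assoc B3.int_pow_mult)
    finally show ?case using F2_mult[OF u(1) v(1)] unfolding F2_def by blast
  qed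
qed

section \<open>Shadows and child's drawings\<close>

lemma PB_group_rcoset [simp]: "K #>\<^bsub>PB_group n\<^esub> g = K #>\<^bsub>braid_group n\<^esub> g"
  by (simp add: r_coset_def)

lemma PB_group_int_pow: "g \<in> PB n \<Longrightarrow> g [^]\<^bsub>PB_group n\<^esub> (k::int) = g [^]\<^bsub>braid_group n\<^esub> k"
  unfolding PB_group_def
  using group.int_pow_consistent[OF group_braid_group PB_subgroup] by metis

lemma N_PB3_normal_PB:
  assumes "N \<lhd> B4"
  shows "N_PB3 N \<lhd> PB_group 3"
  unfolding PB_group_def
  by (rule B3.normal_restrict_supergroup[OF PB_subgroup N_PB3_normal[OF assms]])
    (auto simp: N_PB3_def)

lemma group_hom_N_PB3:
  assumes "N \<lhd> B4"
  shows "group_hom B3 (B3 Mod N_PB3 N) (\<lambda>g. N_PB3 N #>\<^bsub>B3\<^esub> g)"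
  using normal.r_coset_hom_Mod[OF N_PB3_normal[OF assms]]
    normal.factorgroup_is_group[OF N_PB3_normal[OF assms]]
  by (intro group_hom.intro group_hom_axioms.intro group_braid_group)

lemma N_ord_dvd:
  "int (group.ord (PB_group 3 Mod N_PB3 N) (N_PB3 N #>\<^bsub>PB_group 3\<^esub> g)) dvd int (N_ord N)"
  if "g \<in> {x12, x23, central}"
proof -
  have "group.ord (PB_group 3 Mod N_PB3 N) (N_PB3 N #>\<^bsub>PB_group 3\<^esub> g) dvd N_ord N"
    using that unfolding N_ord_def Let_def
    by (elim insertE emptyE) (simp_all only: dvd_lcm1 dvd_lcm2 dvd_lcmI1 dvd_lcmI2)
  thus ?thesis by simp
qed

lemma rcoset_pow_N_ord:
  assumes N: "N \<lhd> B4" and g: "g \<in> {x12, x23, central}" and k: "int (N_ord N) dvd k"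
  shows "N_PB3 N #>\<^bsub>B3\<^esub> g [^]\<^bsub>B3\<^esub> k = N_PB3 N"
proof -
  interpret K: normal "N_PB3 N" "PB_group 3" by (rule N_PB3_normal_PB[OF N])
  interpret Q: group "PB_group 3 Mod N_PB3 N" by (rule K.factorgroup_is_group)
  have gP: "g \<in> PB 3" using g pure_gens_3_in_PB central_in_PB by blast
  let ?q = "N_PB3 N #>\<^bsub>PB_group 3\<^esub> g"
  have q: "?q \<in> carrier (PB_group 3 Mod N_PB3 N)"
    using gP by (auto simp: carrier_FactGroup)
  have "int (Q.ord ?q) dvd k"
    using N_ord_dvd[OF g] k by (rule dvd_trans)
  hence "?q [^]\<^bsub>PB_group 3 Mod N_PB3 N\<^esub> k = \<one>\<^bsub>PB_group 3 Mod N_PB3 N\<^esub>"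
    using Q.int_pow_eq_id[OF q] by simp
  thus ?thesis
    using K.FactGroup_int_pow[of g k] gP by (simp add: PB_group_int_pow)
qed

lemma rcoset_pow_cong:
  assumes N: "N \<lhd> B4" and g: "g \<in> {x12, x23, central}" and k: "[k = l] (mod int (N_ord N))"
  shows "N_PB3 N #>\<^bsub>B3\<^esub> g [^]\<^bsub>B3\<^esub> k = N_PB3 N #>\<^bsub>B3\<^esub> g [^]\<^bsub>B3\<^esub> l"
proof -
  interpret Q: group_hom B3 "B3 Mod N_PB3 N" "\<lambda>g. N_PB3 N #>\<^bsub>B3\<^esub> g"
    by (rule group_hom_N_PB3[OF N])
  have gc: "g \<in> carrier B3" using g by (elim insertE emptyE) simp_all
  have "int (N_ord N) dvd k - l" using k by (simp add: cong_iff_dvd_diff)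
  from rcoset_pow_N_ord[OF N g this]
  have "N_PB3 N #>\<^bsub>B3\<^esub> g [^]\<^bsub>B3\<^esub> (k - l) = \<one>\<^bsub>B3 Mod N_PB3 N\<^esub>" by simp
  moreover have "g [^]\<^bsub>B3\<^esub> k = g [^]\<^bsub>B3\<^esub> (k - l) \<otimes>\<^bsub>B3\<^esub> g [^]\<^bsub>B3\<^esub> l"
    using gc by (simp add: B3.int_pow_mult [symmetric])
  ultimately show ?thesis using gc Q.hom_mult[of "g [^]\<^bsub>B3\<^esub> (k - l)" "g [^]\<^bsub>B3\<^esub> l"]
      Q.H.l_one[OF Q.hom_closed[of "g [^]\<^bsub>B3\<^esub> l"]] by (simp del: mult_FactGroup one_FactGroup)
qed

text \<open>\<open>N_ord\<close> is built from the orders of \<open>x12\<close>, \<open>x23\<close>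
  and \<open>central\<close>, but the third passport entry needs the order of
  \<open>x12 x23\<close>. That product is conjugate to \<open>central\<close> times the inverse of
  \<open>x23\<close>, whose factors commute, so normality of \<open>N_PB3 N\<close> in
  \<open>B3\<close> gives the claim.\<close>

lemma rcoset_x12_x23_pow_N_ord:
  assumes N: "N \<lhd> B4" and k: "int (N_ord N) dvd k"
  shows "(x12 \<otimes>\<^bsub>B3\<^esub> x23) [^]\<^bsub>B3\<^esub> k \<in> N_PB3 N"
proof -
  interpret K: normal "N_PB3 N" B3 by (rule N_PB3_normal[OF N])
  have mem: "g [^]\<^bsub>B3\<^esub> k \<in> N_PB3 N" if g: "g \<in> {x12, x23, central}" for g
  proof -
    have "g \<in> carrier B3" using g by (elim insertE emptyE) simp_all
    hence "g [^]\<^bsub>B3\<^esub> k \<in> N_PB3 N #>\<^bsub>B3\<^esub> g [^]\<^bsub>B3\<^esub> k"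
      by (intro B3.rcos_self K.is_subgroup B3.int_pow_closed)
    thus ?thesis unfolding rcoset_pow_N_ord[OF N g k] .
  qed
  have comm: "central \<otimes>\<^bsub>B3\<^esub> inv\<^bsub>B3\<^esub> x23 = inv\<^bsub>B3\<^esub> x23 \<otimes>\<^bsub>B3\<^esub> central"
    by (rule central_commute_F2[OF F2_inv[OF F2_gens(2)]])
  have "(x12 \<otimes>\<^bsub>B3\<^esub> x23) [^]\<^bsub>B3\<^esub> k
      = s1 \<otimes>\<^bsub>B3\<^esub> (central [^]\<^bsub>B3\<^esub> k \<otimes>\<^bsub>B3\<^esub> inv\<^bsub>B3\<^esub> (x23 [^]\<^bsub>B3\<^esub> k)) \<otimes>\<^bsub>B3\<^esub> inv\<^bsub>B3\<^esub> s1"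
    unfolding x12_x23_conj
    by (simp add: B3.conj_int_pow B3.int_pow_mult_distrib[OF comm] B3.int_pow_inv)
  thus ?thesis
    using mem[of central] mem[of x23] K.inv_op_closed2[of s1] by simp
qed

text \<open>Modulo \<open>N_PB3 N\<close> the hexagon relations hold verbatim for the images of the braid generators,
  so \<open>hexagon_conj\<close> applies in the quotient.  The conjugator found there is a pure braid; its
  central part may be dropped, which leaves an element of the free group.\<close>

lemma hexagons_product_conj:
  assumes N: "N \<lhd> B4" and f: "f \<in> F2" and hex: "hexagons N m f"
  obtains h where "h \<in> F2"
    "N_PB3 N #>\<^bsub>B3\<^esub> (x12 [^]\<^bsub>B3\<^esub> (2 * m + 1) \<otimes>\<^bsub>B3\<^esub> (inv\<^bsub>B3\<^esub> f \<otimes>\<^bsub>B3\<^esub> x23 [^]\<^bsub>B3\<^esub> (2 * m + 1) \<otimes>\<^bsub>B3\<^esub> f))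
      = N_PB3 N #>\<^bsub>B3\<^esub> (h \<otimes>\<^bsub>B3\<^esub> (x12 \<otimes>\<^bsub>B3\<^esub> x23) [^]\<^bsub>B3\<^esub> (2 * m + 1) \<otimes>\<^bsub>B3\<^esub> inv\<^bsub>B3\<^esub> h)"
proof -
  let ?\<pi> = "\<lambda>g. N_PB3 N #>\<^bsub>B3\<^esub> g"
  let ?Q = "B3 Mod N_PB3 N"
  define \<pi> where "\<pi> = ?\<pi>"
  interpret Q: group_hom B3 ?Q \<pi>
    unfolding \<pi>_def by (rule group_hom_N_PB3[OF N])
  have fc: "f \<in> carrier B3" using f by (rule F2_closed)
  interpret Q: braid_pair ?Q "\<pi> s1" "\<pi> s2"
  proof
    show "\<pi> s1 \<in> carrier ?Q" "\<pi> s2 \<in> carrier ?Q" by simp_all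
    show "\<pi> s1 \<otimes>\<^bsub>?Q\<^esub> \<pi> s2 \<otimes>\<^bsub>?Q\<^esub> \<pi> s1 = \<pi> s2 \<otimes>\<^bsub>?Q\<^esub> \<pi> s1 \<otimes>\<^bsub>?Q\<^esub> \<pi> s2"
      using arg_cong[OF B3.braid, of \<pi>] by (simp only: Q.hom_mult B3.a B3.b B3.m_closed)
  qed
  have gens: "\<pi> x12 = \<pi> s1 \<otimes>\<^bsub>?Q\<^esub> \<pi> s1" "\<pi> x23 = \<pi> s2 \<otimes>\<^bsub>?Q\<^esub> \<pi> s2" "\<pi> central = Q.c"
    unfolding central_eq unfolding pure_gen_3
    by (simp_all only: Q.hom_mult Q.hom_inv B3.a B3.b B3.m_closed B3.inv_closed)
  note hom = Q.hom_mult Q.hom_inv Q.hom_int_pow B3.a B3.b B3.m_closed B3.inv_closed B3.int_pow_closed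
    pure_gens_3_closed central_closed fc
  have 1: "\<pi> (s1 \<otimes>\<^bsub>B3\<^esub> x12 [^]\<^bsub>B3\<^esub> m \<otimes>\<^bsub>B3\<^esub> inv\<^bsub>B3\<^esub> f \<otimes>\<^bsub>B3\<^esub> s2 \<otimes>\<^bsub>B3\<^esub> x23 [^]\<^bsub>B3\<^esub> m \<otimes>\<^bsub>B3\<^esub> f)
       = \<pi> (inv\<^bsub>B3\<^esub> f \<otimes>\<^bsub>B3\<^esub> s1 \<otimes>\<^bsub>B3\<^esub> s2 \<otimes>\<^bsub>B3\<^esub> x12 [^]\<^bsub>B3\<^esub> (- m) \<otimes>\<^bsub>B3\<^esub> central [^]\<^bsub>B3\<^esub> m)"
    and 2: "\<pi> (inv\<^bsub>B3\<^esub> f \<otimes>\<^bsub>B3\<^esub> s2 \<otimes>\<^bsub>B3\<^esub> x23 [^]\<^bsub>B3\<^esub> m \<otimes>\<^bsub>B3\<^esub> f \<otimes>\<^bsub>B3\<^esub> s1 \<otimes>\<^bsub>B3\<^esub> x12 [^]\<^bsub>B3\<^esub> m)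
       = \<pi> (s2 \<otimes>\<^bsub>B3\<^esub> s1 \<otimes>\<^bsub>B3\<^esub> x23 [^]\<^bsub>B3\<^esub> (- m) \<otimes>\<^bsub>B3\<^esub> central [^]\<^bsub>B3\<^esub> m \<otimes>\<^bsub>B3\<^esub> f)"
    using hex unfolding hexagons_def Let_def \<pi>_def by (rule conjunct1, rule conjunct2)
  obtain v and j :: int where v: "v \<in> F2"
    and vj: "s1 \<otimes>\<^bsub>B3\<^esub> inv\<^bsub>B3\<^esub> f \<otimes>\<^bsub>B3\<^esub> inv\<^bsub>B3\<^esub> s1 = v \<otimes>\<^bsub>B3\<^esub> central [^]\<^bsub>B3\<^esub> j"
    using s1_conj_F2[OF F2_inv[OF f]] by blast
  have vc: "v \<in> carrier B3" using v by (rule F2_closed)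
  let ?w = "(x12 \<otimes>\<^bsub>B3\<^esub> x23) [^]\<^bsub>B3\<^esub> (2 * m + 1)"
  \<comment> \<open>\<open>?g\<close> below is the conjugator from \<open>hexagon_conj\<close>, and
    \<open>?h\<close> is \<open>?g\<close> without its power of \<open>central\<close>.\<close>
  let ?h = "x12 [^]\<^bsub>B3\<^esub> m \<otimes>\<^bsub>B3\<^esub> v"
  let ?g = "x12 [^]\<^bsub>B3\<^esub> m \<otimes>\<^bsub>B3\<^esub> (s1 \<otimes>\<^bsub>B3\<^esub> inv\<^bsub>B3\<^esub> f \<otimes>\<^bsub>B3\<^esub> inv\<^bsub>B3\<^esub> s1)"
  have "\<pi> (x12 [^]\<^bsub>B3\<^esub> (2 * m + 1) \<otimes>\<^bsub>B3\<^esub> (inv\<^bsub>B3\<^esub> f \<otimes>\<^bsub>B3\<^esub> x23 [^]\<^bsub>B3\<^esub> (2 * m + 1) \<otimes>\<^bsub>B3\<^esub> f))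
      = \<pi> (?g \<otimes>\<^bsub>B3\<^esub> ?w \<otimes>\<^bsub>B3\<^esub> inv\<^bsub>B3\<^esub> ?g)"
    using Q.hexagon_conj[of "\<pi> f" m, folded gens(3), folded gens(1,2)] 1 2
    by (simp only: hom Q.hom_closed)
  moreover have "?g \<otimes>\<^bsub>B3\<^esub> ?w \<otimes>\<^bsub>B3\<^esub> inv\<^bsub>B3\<^esub> ?g = ?h \<otimes>\<^bsub>B3\<^esub> ?w \<otimes>\<^bsub>B3\<^esub> inv\<^bsub>B3\<^esub> ?h"
  proof -
    have *: "h \<otimes>\<^bsub>B3\<^esub> z \<otimes>\<^bsub>B3\<^esub> w \<otimes>\<^bsub>B3\<^esub> inv\<^bsub>B3\<^esub> (h \<otimes>\<^bsub>B3\<^esub> z) = h \<otimes>\<^bsub>B3\<^esub> w \<otimes>\<^bsub>B3\<^esub> inv\<^bsub>B3\<^esub> h"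
      if "h \<in> carrier B3" "z \<in> carrier B3" "w \<in> carrier B3" "z \<otimes>\<^bsub>B3\<^esub> w = w \<otimes>\<^bsub>B3\<^esub> z" for h z w
    proof -
      have "h \<otimes>\<^bsub>B3\<^esub> z \<otimes>\<^bsub>B3\<^esub> w \<otimes>\<^bsub>B3\<^esub> inv\<^bsub>B3\<^esub> (h \<otimes>\<^bsub>B3\<^esub> z)
          = h \<otimes>\<^bsub>B3\<^esub> (z \<otimes>\<^bsub>B3\<^esub> w) \<otimes>\<^bsub>B3\<^esub> inv\<^bsub>B3\<^esub> z \<otimes>\<^bsub>B3\<^esub> inv\<^bsub>B3\<^esub> h"
        using that(1-3) by (simp add: B3.m_assoc B3.inv_mult_group)
      thus ?thesis unfolding that(4) using that(1-3) by (simp add: B3.m_assoc)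
    qed
    have "?g = ?h \<otimes>\<^bsub>B3\<^esub> central [^]\<^bsub>B3\<^esub> j"
      unfolding vj using vc by (simp only: B3.m_assoc hom)
    thus ?thesis
      by (simp only:) (rule *, simp_all only: hom vc central_pow_commute_F2 F2_int_pow F2_mult F2_gens)
  qed
  ultimately have "\<pi> (x12 [^]\<^bsub>B3\<^esub> (2 * m + 1) \<otimes>\<^bsub>B3\<^esub> (inv\<^bsub>B3\<^esub> f \<otimes>\<^bsub>B3\<^esub> x23 [^]\<^bsub>B3\<^esub> (2 * m + 1) \<otimes>\<^bsub>B3\<^esub> f))
      = \<pi> (?h \<otimes>\<^bsub>B3\<^esub> ?w \<otimes>\<^bsub>B3\<^esub> inv\<^bsub>B3\<^esub> ?h)" by simp
  thus thesis
    using that[of ?h] F2_mult[OF F2_int_pow[OF F2_gens(1)] v] unfolding \<pi>_def by blast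
qed

section \<open>Homomorphisms on \<open>F2\<close>, their conjugacy classes and passports\<close>

lemma group_F2_group: "group F2_group"
  unfolding F2_group_def by (rule subgroup.subgroup_is_group[OF F2_subgroup group_braid_group])

lemma F2_group_simps [simp]:
  "carrier F2_group = F2" "monoid.mult F2_group = monoid.mult B3" "monoid.one F2_group = monoid.one B3"
  by (simp_all add: F2_group_def)

lemma F2_group_hom_simps:
  assumes \<psi>: "\<psi> \<in> hom F2_group G" and G: "group G"
  shows "u \<in> F2 \<Longrightarrow> \<psi> u \<in> carrier G"
    "u \<in> F2 \<Longrightarrow> v \<in> F2 \<Longrightarrow> \<psi> (u \<otimes>\<^bsub>B3\<^esub> v) = \<psi> u \<otimes>\<^bsub>G\<^esub> \<psi> v"
    "u \<in> F2 \<Longrightarrow> \<psi> (inv\<^bsub>B3\<^esub> u) = inv\<^bsub>G\<^esub> (\<psi> u)"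
    "u \<in> F2 \<Longrightarrow> \<psi> (u [^]\<^bsub>B3\<^esub> (k::int)) = \<psi> u [^]\<^bsub>G\<^esub> k"
proof -
  interpret group_hom F2_group G \<psi>
    by (intro group_hom.intro group_hom_axioms.intro group_F2_group G \<psi>)
  show "u \<in> F2 \<Longrightarrow> \<psi> u \<in> carrier G" using hom_closed by simp
  show "u \<in> F2 \<Longrightarrow> v \<in> F2 \<Longrightarrow> \<psi> (u \<otimes>\<^bsub>B3\<^esub> v) = \<psi> u \<otimes>\<^bsub>G\<^esub> \<psi> v" using hom_mult by simp
  show "u \<in> F2 \<Longrightarrow> \<psi> (inv\<^bsub>B3\<^esub> u) = inv\<^bsub>G\<^esub> (\<psi> u)"
    using hom_inv[of u] B3.m_inv_consistent[OF F2_subgroup] by (simp add: F2_group_def)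
  show "u \<in> F2 \<Longrightarrow> \<psi> (u [^]\<^bsub>B3\<^esub> (k::int)) = \<psi> u [^]\<^bsub>G\<^esub> k"
    using hom_int_pow[of u k] B3.int_pow_consistent[OF F2_subgroup, of u k] by (simp add: F2_group_def)
qed

lemma hom_passport_conj:
  assumes \<psi>: "\<psi> \<in> hom F2_group (sym_group d)" and g: "g \<in> carrier (sym_group d)"
    and \<chi>: "\<And>w. w \<in> F2 \<Longrightarrow> \<chi> w = g \<otimes>\<^bsub>sym_group d\<^esub> \<psi> w \<otimes>\<^bsub>sym_group d\<^esub> inv\<^bsub>sym_group d\<^esub> g"
  shows "hom_passport d \<chi> = hom_passport d \<psi>"
proof -
  interpret S: group "sym_group d" by (rule sym_group_is_group)
  have p: "\<psi> x12 \<in> carrier (sym_group d)" "\<psi> x23 \<in> carrier (sym_group d)"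
    using F2_group_hom_simps(1)[OF \<psi> S.is_group] F2_gens by blast+
  have *: "inv\<^bsub>sym_group d\<^esub> (\<chi> x23) \<otimes>\<^bsub>sym_group d\<^esub> inv\<^bsub>sym_group d\<^esub> (\<chi> x12)
      = g \<otimes>\<^bsub>sym_group d\<^esub> (inv\<^bsub>sym_group d\<^esub> (\<psi> x23) \<otimes>\<^bsub>sym_group d\<^esub> inv\<^bsub>sym_group d\<^esub> (\<psi> x12))
        \<otimes>\<^bsub>sym_group d\<^esub> inv\<^bsub>sym_group d\<^esub> g"
    unfolding \<chi>[OF F2_gens(1)] \<chi>[OF F2_gens(2)]
    using p g by (simp add: S.inv_mult_group S.m_assoc del: sym_group_inv_equality)
  show ?thesis
    unfolding hom_passport_def * unfolding \<chi>[OF F2_gens(1)] \<chi>[OF F2_gens(2)]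
    using p g by (simp only: cycle_structure_conj_sym_group S.m_closed S.inv_closed)
qed

lemma conj_class_self:
  assumes "\<psi> \<in> hom F2_group (sym_group d)"
  shows "\<psi> \<in> conj_class d \<psi>"
proof -
  interpret S: group "sym_group d" by (rule sym_group_is_group)
  have "\<psi> w = \<one>\<^bsub>sym_group d\<^esub> \<otimes>\<^bsub>sym_group d\<^esub> \<psi> w \<otimes>\<^bsub>sym_group d\<^esub> inv\<^bsub>sym_group d\<^esub> \<one>\<^bsub>sym_group d\<^esub>"
    if "w \<in> F2" for w
    using F2_group_hom_simps(1)[OF assms S.is_group that]
    by (simp del: sym_group_inv_equality)
  thus ?thesis unfolding conj_class_def using assms S.one_closed by blast
qed

lemma passport_conj_class:
  assumes "\<psi> \<in> hom F2_group (sym_group d)"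
  shows "passport d (conj_class d \<psi>) = hom_passport d \<psi>"
proof -
  have "hom_passport d \<chi> = hom_passport d \<psi>" if "\<chi> \<in> conj_class d \<psi>" for \<chi>
    using that hom_passport_conj[OF assms] unfolding conj_class_def by blast
  hence "hom_passport d ` conj_class d \<psi> = {hom_passport d \<psi>}"
    using conj_class_self[OF assms] by blast
  thus ?thesis by (simp add: passport_def)
qed

text \<open>Membership in \<open>Dessin\<close> provides only some representative that kills
  \<open>N_F2 N\<close>; conjugate homomorphisms have the same kernel, so the given one kills it as
  well.\<close>

lemma Dessin_kernel:
  assumes \<psi>: "\<psi> \<in> hom F2_group (sym_group d)" and D: "conj_class d \<psi> \<in> Dessin d N"
    and w: "w \<in> N_F2 N"
  shows "\<psi> w = \<one>\<^bsub>sym_group d\<^esub>"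
proof -
  interpret S: group "sym_group d" by (rule sym_group_is_group)
  obtain \<psi>0 where "conj_class d \<psi> = conj_class d \<psi>0" and ker: "N_F2 N \<subseteq> kernel F2_group (sym_group d) \<psi>0"
    using D unfolding Dessin_def by blast
  hence "\<psi> \<in> conj_class d \<psi>0" using conj_class_self[OF \<psi>] by simp
  moreover have "w \<in> F2" using w by (simp add: N_F2_def)
  ultimately obtain g where g: "g \<in> carrier (sym_group d)"
    and eq: "\<psi> w = g \<otimes>\<^bsub>sym_group d\<^esub> \<psi>0 w \<otimes>\<^bsub>sym_group d\<^esub> inv\<^bsub>sym_group d\<^esub> g"
    unfolding conj_class_def by blast
  have "\<psi>0 w = \<one>\<^bsub>sym_group d\<^esub>" using ker w by (auto simp: kernel_def)
  thus ?thesis unfolding eq using g by (simp del: sym_group_inv_equality)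
qed

text \<open>On \<open>F2\<close>, congruence modulo \<open>N_PB3 N\<close> is congruence modulo
  \<open>N_F2 N\<close>, which \<psi> respects. This carries identities from the quotient of
  \<open>B3\<close> over to the target group.\<close>

lemma hom_eq_of_rcoset_eq:
  assumes N: "N \<lhd> B4" and \<psi>: "\<psi> \<in> hom F2_group G" and G: "group G"
    and ker: "\<And>w. w \<in> N_F2 N \<Longrightarrow> \<psi> w = \<one>\<^bsub>G\<^esub>"
    and u: "u \<in> F2" and v: "v \<in> F2" and eq: "N_PB3 N #>\<^bsub>B3\<^esub> u = N_PB3 N #>\<^bsub>B3\<^esub> v"
  shows "\<psi> u = \<psi> v"
proof -
  interpret G: group G by (rule G)
  note hom = F2_group_hom_simps[OF \<psi> G]
  have "u \<otimes>\<^bsub>B3\<^esub> inv\<^bsub>B3\<^esub> v \<in> N_PB3 N"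
    using eq B3.rcoset_eq_iff[OF normal_imp_subgroup[OF N_PB3_normal[OF N]] F2_closed[OF u] F2_closed[OF v]]
    by blast
  hence "\<psi> (u \<otimes>\<^bsub>B3\<^esub> inv\<^bsub>B3\<^esub> v) = \<one>\<^bsub>G\<^esub>"
    using F2_mult[OF u F2_inv[OF v]] by (intro ker) (simp add: N_F2_def)
  hence "\<psi> u \<otimes>\<^bsub>G\<^esub> inv\<^bsub>G\<^esub> (\<psi> v) = \<one>\<^bsub>G\<^esub>"
    using u v by (simp add: hom F2_inv)
  thus ?thesis using hom(1)[OF u] hom(1)[OF v] G.inv_solve_right'[of "\<psi> u" "\<psi> v" "\<one>\<^bsub>G\<^esub>"]
    by (metis G.inv_solve_right' G.l_one G.one_closed)
qed

text \<open>No freeness of the group generated by \<open>x12\<close> and \<open>x23\<close> is needed here: the homomorphism of the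
  ontoness condition maps it into its own image modulo \<open>N_PB3 N\<close>, on which \<open>\<psi>\<close> is defined.\<close>

lemma exists_twisted_hom:
  assumes N: "N \<lhd> B4" and \<psi>: "\<psi> \<in> hom F2_group G" and G: "group G"
    and ker: "\<And>w. w \<in> N_F2 N \<Longrightarrow> \<psi> w = \<one>\<^bsub>G\<^esub>"
    and T: "T \<in> hom (PB_group 3) (PB_group 3 Mod N_PB3 N)"
    and u: "u \<in> F2" "T x12 = N_PB3 N #>\<^bsub>B3\<^esub> u" and v: "v \<in> F2" "T x23 = N_PB3 N #>\<^bsub>B3\<^esub> v"
  obtains \<chi> where "\<chi> \<in> hom F2_group G" "\<chi> x12 = \<psi> u" "\<chi> x23 = \<psi> v"
proof -
  let ?K = "N_PB3 N" and ?Q = "PB_group 3 Mod N_PB3 N"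
  interpret G: group G by (rule G)
  note hom = F2_group_hom_simps[OF \<psi> G]
  interpret K: normal ?K "PB_group 3" by (rule N_PB3_normal_PB[OF N])
  interpret T: group_hom "PB_group 3" ?Q T
    by (intro group_hom.intro group_hom_axioms.intro group_PB_group K.factorgroup_is_group T)
  interpret P: group_hom "PB_group 3" ?Q "\<lambda>g. ?K #>\<^bsub>B3\<^esub> g"
    using K.r_coset_hom_Mod
    by (intro group_hom.intro group_hom_axioms.intro group_PB_group K.factorgroup_is_group) simp
  have F2P: "g \<in> carrier (PB_group 3)" if "g \<in> F2" for g using that F2_subset_PB by auto
  have inv_PB: "inv\<^bsub>PB_group 3\<^esub> g = inv\<^bsub>B3\<^esub> g" if "g \<in> F2" for g
    using B3.m_inv_consistent[OF PB_subgroup] F2P[OF that] by (simp add: PB_group_def)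
  have gen: "\<exists>t\<in>F2. T s = ?K #>\<^bsub>B3\<^esub> t" if "s \<in> {x12, x23}" for s
    using that u v by blast
  have ex: "\<exists>t\<in>F2. T w = ?K #>\<^bsub>B3\<^esub> t" if "w \<in> F2" for w
    using that unfolding F2_def
  proof (induction rule: generate.induct)
    case one
    have "T \<one>\<^bsub>B3\<^esub> = ?K #>\<^bsub>B3\<^esub> \<one>\<^bsub>B3\<^esub>" using T.hom_one P.hom_one by simp
    thus ?case using subgroup.one_closed[OF F2_subgroup] unfolding F2_def by blast
  next
    case (incl s)
    show ?case using gen[OF incl] unfolding F2_def .
  next
    case (inv s)
    from gen[OF inv] obtain t where t: "t \<in> F2" "T s = ?K #>\<^bsub>B3\<^esub> t" by blast
    have s: "s \<in> F2" using inv F2_gens by blast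
    have "T (inv\<^bsub>B3\<^esub> s) = ?K #>\<^bsub>B3\<^esub> inv\<^bsub>B3\<^esub> t"
      using T.hom_inv[OF F2P[OF s]] P.hom_inv[OF F2P[OF t(1)]] t(2)
      unfolding inv_PB[OF s] inv_PB[OF t(1)] by (simp only:)
    thus ?case using F2_inv[OF t(1)] unfolding F2_def by blast
  next
    case (eng g h)
    from eng.IH[folded F2_def] obtain s t where s: "s \<in> F2" "T g = ?K #>\<^bsub>B3\<^esub> s"
      and t: "t \<in> F2" "T h = ?K #>\<^bsub>B3\<^esub> t" by blast
    note gh = eng.hyps[folded F2_def, THEN F2P]
    have "T (g \<otimes>\<^bsub>B3\<^esub> h) = ?K #>\<^bsub>B3\<^esub> (s \<otimes>\<^bsub>B3\<^esub> t)"
      using T.hom_mult[OF gh] P.hom_mult[OF F2P[OF s(1)] F2P[OF t(1)]] s(2) t(2) by simp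
    thus ?case using F2_mult[OF s(1) t(1)] unfolding F2_def by blast
  qed
  \<comment> \<open>\<tau> picks a lift of \<open>T w\<close> to \<open>F2\<close>. By
    \<open>\<psi>_eq\<close> all lifts have the same value under \<psi>, and this makes \<psi> after
    \<tau> multiplicative although \<tau> itself need not be.\<close>
  define \<tau> where "\<tau> w = (SOME t. t \<in> F2 \<and> T w = ?K #>\<^bsub>B3\<^esub> t)" for w
  have \<tau>: "\<tau> w \<in> F2" "T w = ?K #>\<^bsub>B3\<^esub> \<tau> w" if "w \<in> F2" for w
    using someI_ex[of "\<lambda>t. t \<in> F2 \<and> T w = ?K #>\<^bsub>B3\<^esub> t"] ex[OF that] unfolding \<tau>_def by blast+
  have \<psi>_eq: "\<psi> (\<tau> w) = \<psi> t" if "w \<in> F2" "t \<in> F2" "T w = ?K #>\<^bsub>B3\<^esub> t" for w t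
    using hom_eq_of_rcoset_eq[OF N \<psi> G ker \<tau>(1)[OF that(1)] that(2)] \<tau>(2)[OF that(1)] that(3) by simp
  have "(\<lambda>w. \<psi> (\<tau> w)) \<in> hom F2_group G"
  proof (rule homI)
    show "\<psi> (\<tau> w) \<in> carrier G" if "w \<in> carrier F2_group" for w
      using that \<tau>(1) by (intro hom(1)) simp
    fix w w' assume "w \<in> carrier F2_group" "w' \<in> carrier F2_group"
    hence w: "w \<in> F2" "w' \<in> F2" by simp_all
    have "T (w \<otimes>\<^bsub>B3\<^esub> w') = ?K #>\<^bsub>B3\<^esub> (\<tau> w \<otimes>\<^bsub>B3\<^esub> \<tau> w')"
      using T.hom_mult[OF F2P[OF w(1)] F2P[OF w(2)]] \<tau>(2)[OF w(1)] \<tau>(2)[OF w(2)]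
        P.hom_mult[OF F2P[OF \<tau>(1)[OF w(1)]] F2P[OF \<tau>(1)[OF w(2)]]] by simp
    hence "\<psi> (\<tau> (w \<otimes>\<^bsub>B3\<^esub> w')) = \<psi> (\<tau> w \<otimes>\<^bsub>B3\<^esub> \<tau> w')"
      using w \<tau>(1) by (intro \<psi>_eq F2_mult)
    thus "\<psi> (\<tau> (w \<otimes>\<^bsub>F2_group\<^esub> w')) = \<psi> (\<tau> w) \<otimes>\<^bsub>G\<^esub> \<psi> (\<tau> w')"
      using w \<tau>(1) by (simp add: hom(2))
  qed
  from that[OF this] show thesis
    using \<psi>_eq[OF F2_gens(1) u] \<psi>_eq[OF F2_gens(2) v] by blast
qed

theorem theorem3p16:
  fixes N :: "braid set" and d :: nat and \<psi> :: "braid \<Rightarrow> nat \<Rightarrow> nat"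
    and m :: int and f :: braid
  assumes "N \<in> NFI"
    and "\<psi> \<in> hom F2_group (sym_group d)"
    and "conj_class d \<psi> \<in> Dessin d N"
    and "f \<in> F2"
    and "gt_class N m f \<in> GT N"
    and "charming N (gt_class N m f)"
  shows "passport d (dessin_act d \<psi> m f) = passport d (conj_class d \<psi>)"
proof -
  let ?K = "N_PB3 N" and ?S = "sym_group d"
  interpret S: group ?S by (rule sym_group_is_group)
  have N: "N \<lhd> B4" using assms(1) by (simp add: NFI_def)
  note \<psi> = assms(2) and f = assms(4)
  note hom = F2_group_hom_simps[OF \<psi> S.is_group]
  have ker: "\<psi> w = \<one>\<^bsub>?S\<^esub>" if "w \<in> N_F2 N" for w
    by (rule Dessin_kernel[OF \<psi> assms(3) that])
  have coset_eq: "\<psi> u = \<psi> v"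
    if "u \<in> F2" "v \<in> F2" "?K #>\<^bsub>B3\<^esub> u = ?K #>\<^bsub>B3\<^esub> v" for u v
    by (rule hom_eq_of_rcoset_eq[OF N \<psi> S.is_group ker that])
  \<comment> \<open>Membership in \<open>GT N\<close> provides the conditions only for some
    representative \<open>(n, e)\<close> of the class of \<open>(m, f)\<close>. The two are compared
    through \<open>mn\<close> and \<open>fe\<close>.\<close>
  obtain n e where e: "e \<in> F2" and cls: "gt_class N m f = gt_class N n e"
    and hex: "hexagons N n e" and unit: "unit_condition N n" and onto: "onto_condition N n e"
    using assms(5) unfolding GT_def by blast
  have fe: "?K #>\<^bsub>B3\<^esub> f = ?K #>\<^bsub>B3\<^esub> e"
    using cls by (simp add: gt_class_def)
  have mn: "[m = n] (mod int (N_ord N))"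
  proof -
    have "m = m + int (N_ord N) * 0" by simp
    hence "m \<in> {m + int (N_ord N) * k | k. True}" by blast
    also have "\<dots> = {n + int (N_ord N) * k | k. True}"
      using cls by (simp add: gt_class_def)
    finally show ?thesis by (auto simp: cong_def)
  qed
  define k where "k = 2 * m + 1"
  define l where "l = 2 * n + 1"
  have kl: "[k = l] (mod int (N_ord N))"
    unfolding k_def l_def by (intro cong_add cong_mult cong_refl mn)
  obtain t where t: "[l * t = 1] (mod int (N_ord N))"
    using unit unfolding unit_condition_def l_def by blast
  let ?x = "\<psi> x12" and ?y = "\<psi> x23" and ?f = "\<psi> f"
  have xy: "x12 \<otimes>\<^bsub>B3\<^esub> x23 \<in> F2" by (intro F2_mult F2_gens)
  \<comment> \<open>\<open>t\<close> inverts \<open>l\<close> modulo \<open>N_ord N\<close>, so the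
    powers with exponent \<open>l * t - 1\<close> of \<open>x12\<close>, \<open>x23\<close> and
    their product lie in \<open>N_F2 N\<close>. Thus raising their images to the power
    \<open>l\<close> can be undone.\<close>
  have pow_N: "\<psi> w [^]\<^bsub>?S\<^esub> (l * t) = \<psi> w" if w: "w \<in> {x12, x23, x12 \<otimes>\<^bsub>B3\<^esub> x23}" for w
  proof -
    have wF: "w \<in> F2" using w F2_gens xy by blast
    have dvd: "int (N_ord N) dvd l * t - 1" using t by (simp add: cong_iff_dvd_diff)
    have "w [^]\<^bsub>B3\<^esub> (l * t - 1) \<in> ?K"
    proof (cases "w = x12 \<otimes>\<^bsub>B3\<^esub> x23")
      case True
      then show ?thesis using rcoset_x12_x23_pow_N_ord[OF N dvd] by simp
    next
      case False
      hence "w \<in> {x12, x23, central}" using w by blast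
      from rcoset_pow_N_ord[OF N this dvd] show ?thesis
        using B3.rcos_self[OF F2_closed[OF F2_int_pow[OF wF]] normal_imp_subgroup[OF N_PB3_normal[OF N]]]
        by metis
    qed
    hence "\<psi> (w [^]\<^bsub>B3\<^esub> (l * t - 1)) = \<one>\<^bsub>?S\<^esub>"
      using F2_int_pow[OF wF] by (intro ker) (simp add: N_F2_def)
    hence "\<psi> w [^]\<^bsub>?S\<^esub> (l * t - 1) = \<one>\<^bsub>?S\<^esub>" by (simp add: hom(4)[OF wF])
    thus ?thesis
      using S.int_pow_mult[OF hom(1)[OF wF], of "l * t - 1" 1] hom(1)[OF wF] by simp
  qed
  let ?u = "x12 [^]\<^bsub>B3\<^esub> l"
  let ?v = "inv\<^bsub>B3\<^esub> e \<otimes>\<^bsub>B3\<^esub> x23 [^]\<^bsub>B3\<^esub> l \<otimes>\<^bsub>B3\<^esub> e"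
  have u: "?u \<in> F2" and v: "?v \<in> F2"
    by (intro F2_mult F2_inv F2_int_pow F2_gens e)+
  obtain T where "T \<in> hom (PB_group 3) (PB_group 3 Mod ?K)"
    "T x12 = ?K #>\<^bsub>B3\<^esub> ?u" "T x23 = ?K #>\<^bsub>B3\<^esub> ?v"
    using onto unfolding onto_condition_def Let_def l_def by auto
  then obtain \<chi>0 where \<chi>0: "\<chi>0 \<in> hom F2_group ?S" "\<chi>0 x12 = \<psi> ?u" "\<chi>0 x23 = \<psi> ?v"
    using exists_twisted_hom[OF N \<psi> S.is_group ker _ u _ v] by blast
  interpret P: group_hom B3 "B3 Mod ?K" "\<lambda>g. ?K #>\<^bsub>B3\<^esub> g"
    by (rule group_hom_N_PB3[OF N])
  have u_eq: "\<psi> (x12 [^]\<^bsub>B3\<^esub> k) = \<psi> ?u"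
    by (rule coset_eq[OF _ u rcoset_pow_cong[OF N _ kl]]) (simp_all add: F2_int_pow F2_gens)
  have v_eq: "\<psi> (inv\<^bsub>B3\<^esub> f \<otimes>\<^bsub>B3\<^esub> x23 [^]\<^bsub>B3\<^esub> k \<otimes>\<^bsub>B3\<^esub> f) = \<psi> ?v"
  proof (rule coset_eq[OF _ v])
    show "inv\<^bsub>B3\<^esub> f \<otimes>\<^bsub>B3\<^esub> x23 [^]\<^bsub>B3\<^esub> k \<otimes>\<^bsub>B3\<^esub> f \<in> F2"
      by (intro F2_mult F2_inv F2_int_pow F2_gens f)
    have "?K #>\<^bsub>B3\<^esub> x23 [^]\<^bsub>B3\<^esub> k = ?K #>\<^bsub>B3\<^esub> x23 [^]\<^bsub>B3\<^esub> l"
      by (rule rcoset_pow_cong[OF N _ kl]) simp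
    thus "?K #>\<^bsub>B3\<^esub> (inv\<^bsub>B3\<^esub> f \<otimes>\<^bsub>B3\<^esub> x23 [^]\<^bsub>B3\<^esub> k \<otimes>\<^bsub>B3\<^esub> f) = ?K #>\<^bsub>B3\<^esub> ?v"
      using fe by (simp only: P.hom_mult P.hom_inv F2_closed[OF f] F2_closed[OF e]
          pure_gens_3_closed B3.int_pow_closed B3.inv_closed B3.m_closed)
  qed
  define \<chi> where "\<chi> = twisted_hom d \<psi> m f"
  \<comment> \<open>\<open>\<chi>0\<close> shows that the description in \<open>twisted_hom\<close>
    can be satisfied, so the chosen homomorphism has the required values; \<open>u_eq\<close> and
    \<open>v_eq\<close> pass from \<open>(n, e)\<close> to \<open>(m, f)\<close>.\<close>
  have \<chi>: "\<chi> \<in> hom F2_group ?S \<and> \<chi> x12 = \<psi> (x12 [^]\<^bsub>B3\<^esub> (2 * m + 1))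
      \<and> \<chi> x23 = \<psi> (inv\<^bsub>B3\<^esub> f \<otimes>\<^bsub>B3\<^esub> x23 [^]\<^bsub>B3\<^esub> (2 * m + 1) \<otimes>\<^bsub>B3\<^esub> f)"
    unfolding \<chi>_def twisted_hom_def
    by (rule someI[of _ \<chi>0]) (simp add: \<chi>0 u_eq[unfolded k_def] v_eq[unfolded k_def])
  hence \<chi>x: "\<chi> x12 = \<psi> ?u" and \<chi>y: "\<chi> x23 = \<psi> ?v"
    using u_eq v_eq unfolding k_def by simp_all
  have x: "?x \<in> carrier ?S" and y: "?y \<in> carrier ?S" and ec: "\<psi> e \<in> carrier ?S"
    using hom(1) F2_gens e by blast+
  have 1: "cycle_structure d (\<chi> x12) = cycle_structure d ?x"
    unfolding \<chi>x hom(4)[OF F2_gens(1)]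
    using cycle_structure_int_pow[OF x pow_N] by simp
  have \<chi>y': "\<chi> x23 = inv\<^bsub>?S\<^esub> (\<psi> e) \<otimes>\<^bsub>?S\<^esub> ?y [^]\<^bsub>?S\<^esub> l \<otimes>\<^bsub>?S\<^esub> inv\<^bsub>?S\<^esub> (inv\<^bsub>?S\<^esub> (\<psi> e))"
    unfolding \<chi>y S.inv_inv[OF ec]
    by (simp only: hom e F2_gens F2_mult F2_inv F2_int_pow)
  have 2: "cycle_structure d (\<chi> x23) = cycle_structure d ?y"
    unfolding \<chi>y' cycle_structure_conj_sym_group[OF S.inv_closed[OF ec] S.int_pow_closed[OF y]]
    by (rule cycle_structure_int_pow[OF y pow_N]) simp
  obtain h where h: "h \<in> F2" and prod: "?K #>\<^bsub>B3\<^esub> (?u \<otimes>\<^bsub>B3\<^esub> ?v)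
      = ?K #>\<^bsub>B3\<^esub> (h \<otimes>\<^bsub>B3\<^esub> (x12 \<otimes>\<^bsub>B3\<^esub> x23) [^]\<^bsub>B3\<^esub> l \<otimes>\<^bsub>B3\<^esub> inv\<^bsub>B3\<^esub> h)"
    using hexagons_product_conj[OF N e hex] unfolding l_def by blast
  have hc: "\<psi> h \<in> carrier ?S" by (rule hom(1)[OF h])
  \<comment> \<open>The third passport entry belongs to the inverse of a product. The product for
    \<chi> is shown to be conjugate to the \<open>l\<close>-th power of \<open>?p\<close>, and
    inverting gives a conjugate of the \<open>l\<close>-th power of the inverse of
    \<open>?p\<close>.\<close>
  let ?p = "\<psi> (x12 \<otimes>\<^bsub>B3\<^esub> x23)"
  have p: "?p \<in> carrier ?S" by (rule hom(1)[OF xy])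
  have "\<chi> x12 \<otimes>\<^bsub>?S\<^esub> \<chi> x23 = \<psi> (?u \<otimes>\<^bsub>B3\<^esub> ?v)"
    unfolding \<chi>x \<chi>y by (rule hom(2)[OF u v, symmetric])
  also have "\<dots> = \<psi> (h \<otimes>\<^bsub>B3\<^esub> (x12 \<otimes>\<^bsub>B3\<^esub> x23) [^]\<^bsub>B3\<^esub> l \<otimes>\<^bsub>B3\<^esub> inv\<^bsub>B3\<^esub> h)"
    by (rule coset_eq[OF _ _ prod]) (intro F2_mult F2_inv F2_int_pow xy u v h)+
  also have "\<dots> = \<psi> h \<otimes>\<^bsub>?S\<^esub> ?p [^]\<^bsub>?S\<^esub> l \<otimes>\<^bsub>?S\<^esub> inv\<^bsub>?S\<^esub> (\<psi> h)"
    by (simp only: hom(2)[OF F2_mult[OF h F2_int_pow[OF xy]] F2_inv[OF h]] hom(2)[OF h F2_int_pow[OF xy]]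
        hom(3)[OF h] hom(4)[OF xy])
  finally have prod': "\<chi> x12 \<otimes>\<^bsub>?S\<^esub> \<chi> x23 = \<psi> h \<otimes>\<^bsub>?S\<^esub> ?p [^]\<^bsub>?S\<^esub> l \<otimes>\<^bsub>?S\<^esub> inv\<^bsub>?S\<^esub> (\<psi> h)" .
  have \<chi>c: "\<chi> x12 \<in> carrier ?S" "\<chi> x23 \<in> carrier ?S"
    unfolding \<chi>x \<chi>y by (rule hom(1)[OF u], rule hom(1)[OF v])
  have "inv\<^bsub>?S\<^esub> (\<chi> x23) \<otimes>\<^bsub>?S\<^esub> inv\<^bsub>?S\<^esub> (\<chi> x12) = inv\<^bsub>?S\<^esub> (\<chi> x12 \<otimes>\<^bsub>?S\<^esub> \<chi> x23)"
    by (rule S.inv_mult_group[OF \<chi>c, symmetric])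
  also have "\<dots> = \<psi> h \<otimes>\<^bsub>?S\<^esub> (inv\<^bsub>?S\<^esub> ?p) [^]\<^bsub>?S\<^esub> l \<otimes>\<^bsub>?S\<^esub> inv\<^bsub>?S\<^esub> (\<psi> h)"
    unfolding prod' S.int_pow_inv[OF p]
    using hc p by (simp add: S.inv_mult_group S.m_assoc del: sym_group_inv_equality)
  finally have "cycle_structure d (inv\<^bsub>?S\<^esub> (\<chi> x23) \<otimes>\<^bsub>?S\<^esub> inv\<^bsub>?S\<^esub> (\<chi> x12))
      = cycle_structure d ((inv\<^bsub>?S\<^esub> ?p) [^]\<^bsub>?S\<^esub> l)"
    by (simp only: cycle_structure_conj_sym_group[OF hc] S.int_pow_closed S.inv_closed p)
  also have "\<dots> = cycle_structure d (inv\<^bsub>?S\<^esub> ?p)"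
  proof (rule cycle_structure_int_pow)
    show "inv\<^bsub>?S\<^esub> ?p \<in> carrier ?S" using p by (rule S.inv_closed)
    show "(inv\<^bsub>?S\<^esub> ?p) [^]\<^bsub>?S\<^esub> (l * t) = inv\<^bsub>?S\<^esub> ?p"
      unfolding S.int_pow_inv[OF p] by (subst pow_N) simp_all
  qed
  also have "inv\<^bsub>?S\<^esub> ?p = inv\<^bsub>?S\<^esub> ?y \<otimes>\<^bsub>?S\<^esub> inv\<^bsub>?S\<^esub> ?x"
    unfolding hom(2)[OF F2_gens] by (rule S.inv_mult_group[OF x y])
  finally have 3: "cycle_structure d (inv\<^bsub>?S\<^esub> (\<chi> x23) \<otimes>\<^bsub>?S\<^esub> inv\<^bsub>?S\<^esub> (\<chi> x12))
      = cycle_structure d (inv\<^bsub>?S\<^esub> ?y \<otimes>\<^bsub>?S\<^esub> inv\<^bsub>?S\<^esub> ?x)" .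
  have "hom_passport d \<chi> = hom_passport d \<psi>"
    unfolding hom_passport_def 1 2 3 ..
  thus ?thesis
    unfolding dessin_act_def \<chi>_def [symmetric]
    using passport_conj_class[of \<chi> d] passport_conj_class[OF \<psi>] \<chi> by simp
qed

end
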